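(* Consider the reversible nearest-neighbour PCA described in the context, and let $V^*$ be a constant such that $V_\eta\le V^*<\Gamma^{\mathrm{PCA}}$ for every $\eta\in\mathcal{X}\setminus\{\underline{-1},\underline{c}^e,\underline{c}^o,\underline{+1}\}$. For any $\epsilon>0$, the functions $$\beta\mapsto\sup_{\eta\in\mathcal{X}}\mathbb{P}_\eta\big(\tau_{\{\underline{+1},\underline{c}^e,\underline{c}^o,\underline{-1}\}}>e^{\beta(V^*+\epsilon)}\big),\qquad \beta\mapsto\sup_{\eta\in\mathcal{X}}\mathbb{P}_\eta\big(\tau_{\underline{+1}}>e^{\beta(\Gamma^{\mathrm{PCA}}+\epsilon)}\big)$$ are super exponentially small (SES).
   Context: Let $L$ be even, $\Lambda=\{0,\dots,L-1\}^2$ the two-dimensional torus (periodic boundary conditions, Euclidean metric), $\mathcal{X}=\{-1,+1\}^\Lambda$, and let $h\in(0,1)$ be fixed and small (external magnetic field). Put $S_\sigma(i)=\sum_{j\in\Lambda:|i-j|=1}\sigma(j)$. For $\beta>0$ the reversible Probabilistic Cellular Automaton (PCA) is the Markov chain $(\sigma_n)_{n\in\mathbb{N}}$ on $\mathcal{X}$ with transition probabilities $p(\sigma,\eta)=\prod_{i\in\Lambda}p_{i,\sigma}(\eta(i))$, where $p_{i,\sigma}(a)=\frac1{1+\exp\{-2\beta a(S_\sigma(i)+h)\}}$, $a\in\{-1,+1\}$. The virtual energy is $H(\sigma)=-h\sum_{i\in\Lambda}\sigma(i)-\sum_{i\in\Lambda}|S_\sigma(i)+h|$, and the energy cost is $\Delta(\sigma,\eta)=-\lim_{\beta\to\infty}\frac{\log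 p(\sigma,\eta)}{\beta}=\sum_{i\in\Lambda:\,\eta(i)(S_\sigma(i)+h)<0}2|S_\sigma(i)+h|$. The transition energy is $H(\sigma,\eta):=H(\sigma)+\Delta(\sigma,\eta)$. A path is a finite sequence $\omega=(\omega_1,\dots,\omega_n)$ of configurations; its height is $\Phi_\omega=H(\omega_1)$ if $|\omega|=1$ and $\Phi_\omega=\max_{i<|\omega|}H(\omega_i,\omega_{i+1})$ if $|\omega|>1$. $\Phi(\sigma,\eta)$ is the minimum of $\Phi_\omega$ over all paths from $\sigma$ to $\eta$, and $\Phi(A,B):=\min_{\sigma\in A,\eta\in B}\Phi(\sigma,\eta)$. With $\mathcal{I}_\sigma:=\{\eta\mid H(\eta)<H(\sigma)\}$, the stability level is $V_\sigma:=\Phi(\sigma,\mathcal{I}_\sigma)-H(\sigma)$ ($=\infty$ if $\mathcal{I}_\sigma=\emptyset$). $\underline{+1}$ and $\underline{-1}$ are the constant configurations; $\underline{c}^e(i)=(-1)^{i_1+i_2}$ and $\underline{c}^o(i)=(-1)^{i_1+i_2+1}$ for $i=(i_1,i_2)\in\Lambda$ are the chessboard configurations. The critical length is $\lambda:=[2/h]+1$, $[\cdot]$ being the integer part, and $\Gamma^{\mathrm{PCA}}:=-2h\lambda^2+2\lambda(4+h)-2h$. $\tau_A:=\inf\{t>0\mid\sigma_t\in A\}$ is the first hitting time of $A$ and $\mathbb{P}_\eta$ is the law of the chain started at $\eta$. A function $\beta\mapsto f(\beta)$ is super exponentially small (SES) if $\lim_{\beta\to\infty}\frac1\beta\log f(\beta)=-\infty$.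 *)

theory Defs
  imports "HOL-Probability.Probability"
begin

section \<open>The torus and the configurations\<close>

type_synonym site = "nat \<times> nat"
type_synonym config = "site \<Rightarrow> real"

definition torus :: "nat \<Rightarrow> site set" where
  "torus L = {0..<L} \<times> {0..<L}"

definition cyclic_dist :: "nat \<Rightarrow> nat \<Rightarrow> nat \<Rightarrow> real" where
  "cyclic_dist L a b = min \<bar>real a - real b\<bar> (real L - \<bar>real a - real b\<bar>)"

definition torus_dist :: "nat \<Rightarrow> site \<Rightarrow> site \<Rightarrow> real" where
  "torus_dist L i j =
     sqrt ((cyclic_dist L (fst i) (fst j))\<^sup>2 + (cyclic_dist L (snd i) (snd j))\<^sup>2)"

text \<open>Configurations are extensional functions (value \<^term>\<open>undefined\<close> outside the torus), so that
  \<open>configs L\<close> is a finite set in bijection with $\{-1,+1\}^\Lambda$.\<close>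

definition configs :: "nat \<Rightarrow> config set" where
  "configs L = torus L \<rightarrow>\<^sub>E {-1, 1}"

definition plus_config :: "nat \<Rightarrow> config" where
  "plus_config L = restrict (\<lambda>_. 1) (torus L)"

definition minus_config :: "nat \<Rightarrow> config" where
  "minus_config L = restrict (\<lambda>_. -1) (torus L)"

definition chess_even :: "nat \<Rightarrow> config" where
  "chess_even L = restrict (\<lambda>i. (-1) ^ (fst i + snd i)) (torus L)"

definition chess_odd :: "nat \<Rightarrow> config" where
  "chess_odd L = restrict (\<lambda>i. (-1) ^ (fst i + snd i + 1)) (torus L)"

definition local_field :: "nat \<Rightarrow> config \<Rightarrow> site \<Rightarrow> real" where
  "local_field L \<sigma> i = (\<Sum>j | j \<in> torus L \<and> torus_dist L i j = 1. \<sigma> j)"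


section \<open>The dynamics\<close>

definition site_prob :: "nat \<Rightarrow> real \<Rightarrow> real \<Rightarrow> config \<Rightarrow> site \<Rightarrow> real \<Rightarrow> real" where
  "site_prob L h \<beta> \<sigma> i a = 1 / (1 + exp (- 2 * \<beta> * a * (local_field L \<sigma> i + h)))"

definition trans_prob :: "nat \<Rightarrow> real \<Rightarrow> real \<Rightarrow> config \<Rightarrow> config \<Rightarrow> real" where
  "trans_prob L h \<beta> \<sigma> \<eta> = (\<Prod>i\<in>torus L. site_prob L h \<beta> \<sigma> i (\<eta> i))"

definition step_kernel :: "nat \<Rightarrow> real \<Rightarrow> real \<Rightarrow> config \<Rightarrow> config measure" where
  "step_kernel L h \<beta> \<sigma> = point_measure (configs L) (\<lambda>\<eta>. ennreal (trans_prob L h \<beta> \<sigma> \<eta>))"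

text \<open>The conditional law of \<open>\<sigma>\<^sub>n\<close> given the past \<open>\<omega> 0, \<dots>, \<omega> (n - 1)\<close>, for the chain started
  at \<open>\<eta>\<close>.\<close>

definition chain_kernel ::
  "nat \<Rightarrow> real \<Rightarrow> real \<Rightarrow> config \<Rightarrow> nat \<Rightarrow> (nat \<Rightarrow> config) \<Rightarrow> config measure" where
  "chain_kernel L h \<beta> \<eta> n \<omega> =
     (case n of 0 \<Rightarrow> return (count_space (configs L)) \<eta> | Suc m \<Rightarrow> step_kernel L h \<beta> (\<omega> m))"

text \<open>The law \<open>P\<^sub>\<eta>\<close> of the whole trajectory on $\mathcal{X}^{\mathbb{N}}$, given by the Ionescu-Tulcea
  theorem; lemma \<open>emeasure_chain_law_cylinder\<close> below computes its finite-dimensional distributions.\<close>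

definition chain_law :: "nat \<Rightarrow> real \<Rightarrow> real \<Rightarrow> config \<Rightarrow> (nat \<Rightarrow> config) measure" where
  "chain_law L h \<beta> \<eta> =
     projective_family.lim UNIV
       (Ionescu_Tulcea.CI (chain_kernel L h \<beta> \<eta>) (\<lambda>_. count_space (configs L)))
       (\<lambda>_. count_space (configs L))"

definition hitting_time :: "config set \<Rightarrow> (nat \<Rightarrow> config) \<Rightarrow> enat" where
  "hitting_time A \<omega> = Inf {enat t |t. 0 < t \<and> \<omega> t \<in> A}"

definition prob_hitting_gt ::
  "nat \<Rightarrow> real \<Rightarrow> real \<Rightarrow> config \<Rightarrow> config set \<Rightarrow> real \<Rightarrow> real" where
  "prob_hitting_gt L h \<beta> \<eta> A T =
     measure (chain_law L h \<beta> \<eta>)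
       {\<omega> \<in> space (chain_law L h \<beta> \<eta>). ereal T < ereal_of_enat (hitting_time A \<omega>)}"


section \<open>The energy landscape\<close>

definition virtual_energy :: "nat \<Rightarrow> real \<Rightarrow> config \<Rightarrow> real" where
  "virtual_energy L h \<sigma> =
     - h * (\<Sum>i\<in>torus L. \<sigma> i) - (\<Sum>i\<in>torus L. \<bar>local_field L \<sigma> i + h\<bar>)"

text \<open>The explicit form of the limit is lemma \<open>energy_cost_eq\<close> below.\<close>

definition energy_cost :: "nat \<Rightarrow> real \<Rightarrow> config \<Rightarrow> config \<Rightarrow> real" where
  "energy_cost L h \<sigma> \<eta> = - Lim at_top (\<lambda>\<beta>. ln (trans_prob L h \<beta> \<sigma> \<eta>) / \<beta>)"

definition transition_energy :: "nat \<Rightarrow> real \<Rightarrow> config \<Rightarrow> config \<Rightarrow> real" where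
  "transition_energy L h \<sigma> \<eta> = virtual_energy L h \<sigma> + energy_cost L h \<sigma> \<eta>"

definition is_path :: "nat \<Rightarrow> config list \<Rightarrow> bool" where
  "is_path L \<omega> \<longleftrightarrow> \<omega> \<noteq> [] \<and> set \<omega> \<subseteq> configs L"

definition path_height :: "nat \<Rightarrow> real \<Rightarrow> config list \<Rightarrow> real" where
  "path_height L h \<omega> =
     (if length \<omega> = 1 then virtual_energy L h (\<omega> ! 0)
      else Max ((\<lambda>i. transition_energy L h (\<omega> ! i) (\<omega> ! (i + 1))) ` {0..<length \<omega> - 1}))"

text \<open>Heights of paths take finitely many values, so the infima below are minima, except that the
  height between \<open>A\<close> and \<open>{}\<close> is \<open>\<infinity>\<close>.\<close>

definition comm_height :: "nat \<Rightarrow> real \<Rightarrow> config \<Rightarrow> config \<Rightarrow> ereal" where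
  "comm_height L h \<sigma> \<eta> =
     Inf {ereal (path_height L h \<omega>) |\<omega>. is_path L \<omega> \<and> hd \<omega> = \<sigma> \<and> last \<omega> = \<eta>}"

definition comm_height_sets :: "nat \<Rightarrow> real \<Rightarrow> config set \<Rightarrow> config set \<Rightarrow> ereal" where
  "comm_height_sets L h A B = (INF \<sigma>\<in>A. INF \<eta>\<in>B. comm_height L h \<sigma> \<eta>)"

definition lower_energy_set :: "nat \<Rightarrow> real \<Rightarrow> config \<Rightarrow> config set" where
  "lower_energy_set L h \<sigma> =
     {\<eta> \<in> configs L. virtual_energy L h \<eta> < virtual_energy L h \<sigma>}"

definition stability_level :: "nat \<Rightarrow> real \<Rightarrow> config \<Rightarrow> ereal" where
  "stability_level L h \<sigma> =
     comm_height_sets L h {\<sigma>} (lower_energy_set L h \<sigma>) - ereal (virtual_energy L h \<sigma>)"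

definition critical_length :: "real \<Rightarrow> int" where
  "critical_length h = \<lfloor>2 / h\<rfloor> + 1"

definition Gamma_PCA :: "real \<Rightarrow> real" where
  "Gamma_PCA h = - 2 * h * (of_int (critical_length h))\<^sup>2
     + 2 * of_int (critical_length h) * (4 + h) - 2 * h"

text \<open>\<open>ln 0 = 0\<close> in the library; here \<open>log 0\<close> is \<open>-\<infinity>\<close>.\<close>

definition SES :: "(real \<Rightarrow> real) \<Rightarrow> bool" where
  "SES f \<longleftrightarrow>
     ((\<lambda>\<beta>. if f \<beta> = 0 then - \<infinity> else ereal (1 / \<beta> * ln (f \<beta>))) \<longlongrightarrow> - \<infinity>) at_top"


section \<open>The definitions are as intended\<close>

lemma finite_torus [simp, intro]: "finite (torus L)"
  by (simp add: torus_def)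

lemma finite_configs [simp, intro]: "finite (configs L)"
  by (simp add: configs_def finite_PiE)

lemma special_configs:
  "plus_config L \<in> configs L" "minus_config L \<in> configs L"
  "chess_even L \<in> configs L" "chess_odd L \<in> configs L"
  by (auto simp: configs_def plus_config_def minus_config_def chess_even_def chess_odd_def
      minus_one_power_iff)

lemma configs_nonempty [simp]: "configs L \<noteq> {}"
  using special_configs by blast

lemma cyclic_dist_eq:
  "cyclic_dist L a b = of_int (min \<bar>int a - int b\<bar> (int L - \<bar>int a - int b\<bar>))"
proof -
  have "\<bar>real a - real b\<bar> = of_int \<bar>int a - int b\<bar>" by simp
  then show ?thesis
    unfolding cyclic_dist_def by (simp only: of_int_min of_int_diff of_int_of_nat_eq)
qed

lemma torus_dist_eq_1:
  assumes "i \<in> torus L" "j \<in> torus L"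
  shows "torus_dist L i j = 1 \<longleftrightarrow>
    (fst i = fst j \<and> cyclic_dist L (snd i) (snd j) = 1 \<or>
     cyclic_dist L (fst i) (fst j) = 1 \<and> snd i = snd j)"
proof -
  define d e where "d = min \<bar>int (fst i) - int (fst j)\<bar> (int L - \<bar>int (fst i) - int (fst j)\<bar>)"
    and "e = min \<bar>int (snd i) - int (snd j)\<bar> (int L - \<bar>int (snd i) - int (snd j)\<bar>)"
  have bounds: "fst i < L" "snd i < L" "fst j < L" "snd j < L"
    using assms by (auto simp: torus_def)
  have nonneg: "d \<ge> 0" "e \<ge> 0" and zero: "d = 0 \<longleftrightarrow> fst i = fst j" "e = 0 \<longleftrightarrow> snd i = snd j"
    using bounds by (auto simp: d_def e_def min_def)
  have "d\<^sup>2 + e\<^sup>2 = 1 \<longleftrightarrow> d = 0 \<and> e = 1 \<or> d = 1 \<and> e = 0"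
  proof
    assume eq: "d\<^sup>2 + e\<^sup>2 = 1"
    have "\<not> (d \<ge> 1 \<and> e \<ge> 1)"
    proof
      assume "d \<ge> 1 \<and> e \<ge> 1"
      then have "d\<^sup>2 \<ge> 1" "e\<^sup>2 \<ge> 1" by (auto simp: one_le_power)
      with eq show False by linarith
    qed
    then have "d = 0 \<or> e = 0" using nonneg by linarith
    with eq nonneg show "d = 0 \<and> e = 1 \<or> d = 1 \<and> e = 0"
      by (auto simp: power2_eq_1_iff)
  qed auto
  moreover have cyc: "cyclic_dist L (fst i) (fst j) = of_int d" "cyclic_dist L (snd i) (snd j) = of_int e"
    unfolding cyclic_dist_eq d_def e_def by (rule refl)+
  moreover have "torus_dist L i j = 1 \<longleftrightarrow> real_of_int (d\<^sup>2 + e\<^sup>2) = 1"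
    unfolding torus_dist_def cyc by simp
  ultimately have "torus_dist L i j = 1 \<longleftrightarrow> d = 0 \<and> e = 1 \<or> d = 1 \<and> e = 0"
    by (simp only: of_int_eq_1_iff)
  then show ?thesis
    unfolding cyc zero(1)[symmetric] zero(2)[symmetric] by (simp only: of_int_eq_1_iff)
qed

lemma cyclic_dist_eq_1:
  assumes "a < L" "b < L" "2 \<le> L"
  shows "cyclic_dist L a b = 1 \<longleftrightarrow> b = (a + 1) mod L \<or> a = (b + 1) mod L"
proof -
  have "cyclic_dist L a b = 1 \<longleftrightarrow>
      min \<bar>int a - int b\<bar> (int L - \<bar>int a - int b\<bar>) = 1"
    by (simp add: cyclic_dist_eq)
  also have "\<dots> \<longleftrightarrow> b = (if a + 1 = L then 0 else a + 1) \<or> a = (if b + 1 = L then 0 else b + 1)"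
    using assms by (auto simp: min_def abs_if split: if_splits)
  also have "\<dots> \<longleftrightarrow> b = (a + 1) mod L \<or> a = (b + 1) mod L"
    using assms by (auto simp: mod_if)
  finally show ?thesis .
qed

lemma site_prob_pos: "site_prob L h \<beta> \<sigma> i a > 0"
  by (simp add: site_prob_def add_pos_pos)

lemma trans_prob_pos: "trans_prob L h \<beta> \<sigma> \<eta> > 0"
  by (simp add: trans_prob_def site_prob_pos prod_pos)

lemma site_prob_sum: "site_prob L h \<beta> \<sigma> i (-1) + site_prob L h \<beta> \<sigma> i 1 = 1"
proof -
  define x where "x = exp (2 * \<beta> * (local_field L \<sigma> i + h))"
  have x: "x > 0" by (simp add: x_def)
  have "site_prob L h \<beta> \<sigma> i (-1) = 1 / (1 + x)"
    by (simp add: site_prob_def x_def)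
  moreover have "exp (- 2 * \<beta> * (local_field L \<sigma> i + h)) = 1 / x"
    by (simp add: x_def exp_minus inverse_eq_divide)
  then have "site_prob L h \<beta> \<sigma> i 1 = 1 / (1 + 1 / x)"
    by (simp add: site_prob_def)
  ultimately have "site_prob L h \<beta> \<sigma> i (-1) = 1 / (1 + x)" "site_prob L h \<beta> \<sigma> i 1 = 1 / (1 + 1 / x)"
    by simp_all
  moreover have "1 / (1 + x) + 1 / (1 + 1 / x) = 1"
    using x by (simp add: field_simps)
  ultimately show ?thesis by simp
qed

lemma sum_trans_prob: "(\<Sum>\<eta>\<in>configs L. trans_prob L h \<beta> \<sigma> \<eta>) = 1"
proof -
  have "(\<Sum>\<eta>\<in>configs L. trans_prob L h \<beta> \<sigma> \<eta>)
      = (\<Prod>i\<in>torus L. \<Sum>a\<in>{-1, 1}. site_prob L h \<beta> \<sigma> i a)"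
    unfolding configs_def trans_prob_def by (subst prod_sum_PiE) auto
  also have "\<dots> = 1" using site_prob_sum by (auto intro: prod.neutral)
  finally show ?thesis .
qed

lemma space_step_kernel [simp]: "space (step_kernel L h \<beta> \<sigma>) = configs L"
  and sets_step_kernel [simp]: "sets (step_kernel L h \<beta> \<sigma>) = Pow (configs L)"
  by (simp_all add: step_kernel_def space_point_measure sets_point_measure)

lemma prob_space_step_kernel: "prob_space (step_kernel L h \<beta> \<sigma>)"
  unfolding step_kernel_def
  by (rule prob_space_point_measure)
     (auto simp: sum_ennreal less_imp_le[OF trans_prob_pos] sum_trans_prob)

lemma chain_law_Ionescu_Tulcea:
  assumes "\<eta> \<in> configs L"
  shows "Ionescu_Tulcea (chain_kernel L h \<beta> \<eta>) (\<lambda>_. count_space (configs L))"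
proof -
  have meas: "chain_kernel L h \<beta> \<eta> n \<in>
    PiM {0..<n} (\<lambda>_. count_space (configs L)) \<rightarrow>\<^sub>M subprob_algebra (count_space (configs L))" for n
  proof (cases n)
    case 0
    then show ?thesis using assms
      by (auto simp: chain_kernel_def[abs_def] intro!: measurable_const
          prob_space_imp_subprob_space prob_space_return
          simp: space_subprob_algebra)
  next
    case (Suc m)
    have "step_kernel L h \<beta> \<in> count_space (configs L) \<rightarrow>\<^sub>M subprob_algebra (count_space (configs L))"
      by (auto simp: space_subprob_algebra prob_space_imp_subprob_space prob_space_step_kernel)
    moreover have "(\<lambda>\<omega>. \<omega> m) \<in> PiM {0..<n} (\<lambda>_. count_space (configs L)) \<rightarrow>\<^sub>M count_space (configs L)"
      by (rule measurable_component_singleton) (simp add: Suc)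
    ultimately have "(\<lambda>\<omega>. step_kernel L h \<beta> (\<omega> m)) \<in>
        PiM {0..<n} (\<lambda>_. count_space (configs L)) \<rightarrow>\<^sub>M subprob_algebra (count_space (configs L))"
      by (rule measurable_compose[rotated])
    then show ?thesis
      by (simp add: Suc chain_kernel_def[abs_def])
  qed
  have "prob_space (chain_kernel L h \<beta> \<eta> n \<omega>)" for n \<omega>
    using assms by (auto simp: chain_kernel_def prob_space_step_kernel prob_space_return split: nat.split)
  with meas show ?thesis by (auto simp: Ionescu_Tulcea_def)
qed

lemma prob_space_chain_law:
  assumes "\<eta> \<in> configs L"
  shows "prob_space (chain_law L h \<beta> \<eta>)"
    and "sets (chain_law L h \<beta> \<eta>) = sets (PiM UNIV (\<lambda>_. count_space (configs L)))"
    and "space (chain_law L h \<beta> \<eta>) = UNIV \<rightarrow>\<^sub>E configs L"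
proof -
  interpret Ionescu_Tulcea "chain_kernel L h \<beta> \<eta>" "\<lambda>_. count_space (configs L)"
    using assms by (rule chain_law_Ionescu_Tulcea)
  show "sets (chain_law L h \<beta> \<eta>) = sets (PiM UNIV (\<lambda>_. count_space (configs L)))"
    by (simp add: chain_law_def)
  then show "space (chain_law L h \<beta> \<eta>) = UNIV \<rightarrow>\<^sub>E configs L"
    by (subst sets_eq_imp_space_eq[of _ "PiM UNIV (\<lambda>_. count_space (configs L))"]) (auto simp: space_PiM)
  show "prob_space (chain_law L h \<beta> \<eta>)"
  proof
    have "emeasure PF.lim (PF.emb UNIV {} {\<lambda>_. undefined}) = emeasure (CI {}) {\<lambda>_. undefined}"
      by (rule lim) (auto simp: PiM_empty)
    moreover have "PF.emb UNIV {} {\<lambda>_. undefined} = space PF.lim"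
      by (auto simp: prod_emb_def space_PiM)
    moreover have "emeasure (CI {}) {\<lambda>_. undefined} = 1"
      using prob_space.emeasure_space_1[OF PF.prob_space_P[of "{}"]]
      by (simp add: space_PiM CI_def)
    ultimately show "emeasure (chain_law L h \<beta> \<eta>) (space (chain_law L h \<beta> \<eta>)) = 1"
      by (simp add: chain_law_def)
  qed
qed

lemma emeasure_chain_law_cylinder:
  assumes \<eta>: "\<eta> \<in> configs L" and s: "\<And>k. s k \<in> configs L"
  shows "emeasure (chain_law L h \<beta> \<eta>) {\<omega> \<in> space (chain_law L h \<beta> \<eta>). \<forall>k\<le>n. \<omega> k = s k} =
    (if s 0 = \<eta> then ennreal (\<Prod>k<n. trans_prob L h \<beta> (s k) (s (Suc k))) else 0)"
proof -
  interpret Ionescu_Tulcea "chain_kernel L h \<beta> \<eta>" "\<lambda>_. count_space (configs L)"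
    using \<eta> by (rule chain_law_Ionescu_Tulcea)
  let ?M = "\<lambda>_::nat. count_space (configs L)"
  let ?r = "\<lambda>n. restrict s {0..<n}"
  let ?u = "\<lambda>_::nat. undefined :: config"
  have r: "?r n \<in> space (PiM {0..<n} ?M)" for n
    using s by (auto simp: space_PiM)
  have sing: "{?r n} \<in> sets (PiM {0..<n} ?M)" for n
  proof -
    have "{?r n} = PiE {0..<n} (\<lambda>k. {s k})" by (metis (lifting) PiE_eq_singleton)
    also have "\<dots> \<in> sets (PiM {0..<n} ?M)" using s by (intro sets_PiM_I_finite) auto
    finally show ?thesis .
  qed
  have step: "emeasure (C 0 (Suc n) ?u) {?r (Suc n)} =
      emeasure (chain_kernel L h \<beta> \<eta> n (?r n)) {s n} * emeasure (C 0 n ?u) {?r n}" for n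
  proof -
    have u: "?u \<in> space (PiM {0..<0} ?M)" by (simp add: space_PiM)
    have "emeasure (C 0 (Suc n) ?u) {?r (Suc n)} = (\<integral>\<^sup>+\<omega>. emeasure (eP n \<omega>) {?r (Suc n)} \<partial>C 0 n ?u)"
      using measurable_eP[of n] sing[of "Suc n"] prob_space_C[OF u, of n]
      by (simp, subst emeasure_bind[where N="PiM {0..<Suc n} ?M"])
         (auto simp: prob_space.not_empty measurable_cong_sets[OF sets_C[OF u] refl])
    also have "\<dots> = (\<integral>\<^sup>+\<omega>. emeasure (chain_kernel L h \<beta> \<eta> n (?r n)) {s n} * indicator {?r n} \<omega> \<partial>C 0 n ?u)"
    proof (rule nn_integral_cong)
      fix \<omega> assume "\<omega> \<in> space (C 0 n ?u)"
      then have \<omega>: "\<omega> \<in> space (PiM {0..<n} ?M)" using space_C[OF u, of n] by simp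
      have "fun_upd \<omega> n -` {?r (Suc n)} \<inter> space (?M n) = (if \<omega> = ?r n then {s n} else {})"
      proof -
        have "fun_upd \<omega> n x = ?r (Suc n) \<longleftrightarrow> \<omega> = ?r n \<and> x = s n" for x
        proof
          assume eq: "fun_upd \<omega> n x = ?r (Suc n)"
          have "\<omega> k = ?r n k" for k
            using fun_cong[OF eq, of k] \<omega> by (cases "k = n") (auto simp: space_PiM PiE_def extensional_def)
          moreover have "x = s n" using fun_cong[OF eq, of n] by simp
          ultimately show "\<omega> = ?r n \<and> x = s n" by auto
        qed (auto simp: fun_eq_iff)
        then show ?thesis using s by auto
      qed
      then show "emeasure (eP n \<omega>) {?r (Suc n)} =
          emeasure (chain_kernel L h \<beta> \<eta> n (?r n)) {s n} * indicator {?r n} \<omega>"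
        by (subst emeasure_eP[OF \<omega> sing]) (auto split: split_indicator)
    qed
    also have "\<dots> = emeasure (chain_kernel L h \<beta> \<eta> n (?r n)) {s n} * emeasure (C 0 n ?u) {?r n}"
      using sing[of n] sets_C[OF u, of n] by (intro nn_integral_cmult_indicator) auto
    finally show ?thesis .
  qed
  have C0: "emeasure (C 0 0 ?u) {?r 0} = 1"
    by (simp add: space_PiM PiM_empty restrict_def)
  have "emeasure (C 0 (Suc n) ?u) {?r (Suc n)} =
    (if s 0 = \<eta> then ennreal (\<Prod>k<n. trans_prob L h \<beta> (s k) (s (Suc k))) else 0)" for n
  proof (induction n)
    case 0
    show ?case using s[of 0] C0 by (subst step) (auto simp: chain_kernel_def split: split_indicator)
  next
    case (Suc n)
    have "emeasure (step_kernel L h \<beta> (s n)) {s (Suc n)} = ennreal (trans_prob L h \<beta> (s n) (s (Suc n)))"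
      unfolding step_kernel_def using s by (subst emeasure_point_measure_finite) auto
    then have "emeasure (chain_kernel L h \<beta> \<eta> (Suc n) (?r (Suc n))) {s (Suc n)}
        = ennreal (trans_prob L h \<beta> (s n) (s (Suc n)))"
      by (simp add: chain_kernel_def)
    then show ?case
      by (subst step, subst Suc.IH)
         (auto simp: ennreal_mult' mult.commute less_imp_le[OF trans_prob_pos])
  qed
  moreover have "emeasure (CI {0..<Suc n}) {?r (Suc n)} = emeasure (C 0 (Suc n) ?u) {?r (Suc n)}"
  proof -
    have up: "up_to {0..<Suc n} = Suc n"
      using up_to_iff_Ico[of "{0..<Suc n}"] by (intro antisym) (auto simp: Suc_le_eq up_to_less)
    have u: "?u \<in> space (PiM {0..<0} ?M)" by (simp add: space_PiM)
    show ?thesis unfolding CI_def up using distr_C[OF order.refl u, of "Suc n"] by simp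
  qed
  moreover have "emeasure PF.lim (PF.emb UNIV {0..<Suc n} {?r (Suc n)}) = emeasure (CI {0..<Suc n}) {?r (Suc n)}"
    by (rule lim[OF _ sing]) auto
  moreover have "PF.emb UNIV {0..<Suc n} {?r (Suc n)} =
      {\<omega> \<in> space (chain_law L h \<beta> \<eta>). \<forall>k\<le>n. \<omega> k = s k}"
    unfolding prob_space_chain_law(3)[OF \<eta>]
    by (auto simp: prod_emb_def space_PiM restrict_def fun_eq_iff less_Suc_eq_le split: if_splits)
  ultimately show ?thesis by (simp add: chain_law_def)
qed

lemma sets_hitting_gt:
  assumes "\<eta> \<in> configs L"
  shows "{\<omega> \<in> space (chain_law L h \<beta> \<eta>). ereal T < ereal_of_enat (hitting_time A \<omega>)}
    \<in> sets (chain_law L h \<beta> \<eta>)"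
proof -
  have meas: "(\<lambda>\<omega>. \<omega> t) \<in> chain_law L h \<beta> \<eta> \<rightarrow>\<^sub>M count_space (configs L)" for t
    unfolding measurable_cong_sets[OF prob_space_chain_law(2)[OF assms] refl]
    by (rule measurable_component_singleton) simp
  have "ereal T < ereal_of_enat (hitting_time A \<omega>) \<longleftrightarrow>
      (\<forall>t. 0 < t \<and> real t \<le> T \<longrightarrow> \<omega> t \<notin> A)" for \<omega>
  proof (cases "\<exists>t>0. \<omega> t \<in> A")
    case False
    then have "hitting_time A \<omega> = \<infinity>" by (auto simp: hitting_time_def Inf_enat_def)
    moreover have "\<And>t. 0 < t \<Longrightarrow> \<omega> t \<notin> A" using False by blast
    ultimately show ?thesis by auto
  next
    case True
    define t0 where "t0 = (LEAST t. 0 < t \<and> \<omega> t \<in> A)"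
    have t0: "0 < t0" "\<omega> t0 \<in> A" "\<And>t. 0 < t \<Longrightarrow> \<omega> t \<in> A \<Longrightarrow> t0 \<le> t"
      using LeastI_ex[of "\<lambda>t. 0 < t \<and> \<omega> t \<in> A"] True
      by (auto simp: t0_def intro: Least_le)
    have "hitting_time A \<omega> = enat t0"
      unfolding hitting_time_def
      by (rule antisym) (use t0 in \<open>auto intro!: Inf_lower Inf_greatest\<close>)
    then have "ereal T < ereal_of_enat (hitting_time A \<omega>) \<longleftrightarrow> T < real t0" by simp
    also have "\<dots> \<longleftrightarrow> (\<forall>t. 0 < t \<and> real t \<le> T \<longrightarrow> \<omega> t \<notin> A)"
    proof
      assume "T < real t0"
      show "\<forall>t. 0 < t \<and> real t \<le> T \<longrightarrow> \<omega> t \<notin> A"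
      proof (intro allI impI notI)
        fix t assume "0 < t \<and> real t \<le> T" "\<omega> t \<in> A"
        with t0(3)[of t] have "real t0 \<le> real t" by simp
        with \<open>T < real t0\<close> \<open>0 < t \<and> real t \<le> T\<close> show False by linarith
      qed
    next
      assume "\<forall>t. 0 < t \<and> real t \<le> T \<longrightarrow> \<omega> t \<notin> A"
      with t0(1,2) show "T < real t0" using not_less by blast
    qed
    finally show ?thesis .
  qed
  then have "{\<omega> \<in> space (chain_law L h \<beta> \<eta>). ereal T < ereal_of_enat (hitting_time A \<omega>)} =
    {\<omega> \<in> space (chain_law L h \<beta> \<eta>). \<forall>t. 0 < t \<and> real t \<le> T \<longrightarrow> \<omega> t \<notin> A}" by simp
  also have "\<dots> \<in> sets (chain_law L h \<beta> \<eta>)"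
  proof -
    have "{\<omega> \<in> space (chain_law L h \<beta> \<eta>). \<omega> t \<notin> A} \<in> sets (chain_law L h \<beta> \<eta>)" for t
    proof -
      have "{\<omega> \<in> space (chain_law L h \<beta> \<eta>). \<omega> t \<notin> A} =
          (\<lambda>\<omega>. \<omega> t) -` (configs L - A) \<inter> space (chain_law L h \<beta> \<eta>)"
        using measurable_space[OF meas[of t]] by auto
      also have "\<dots> \<in> sets (chain_law L h \<beta> \<eta>)"
        by (rule measurable_sets[OF meas]) auto
      finally show ?thesis .
    qed
    then show ?thesis
      by (intro sets.sets_Collect_countable_All sets.sets_Collect_imp sets.sets_Collect_const)
  qed
  finally show ?thesis .
qed

lemma ln_site_prob_tendsto:
  "((\<lambda>\<beta>. ln (site_prob L h \<beta> \<sigma> i a) / \<beta>) \<longlongrightarrow> - max 0 (- 2 * a * (local_field L \<sigma> i + h))) at_top"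
proof -
  define x where "x = - 2 * a * (local_field L \<sigma> i + h)"
  have "((\<lambda>\<beta>. - (ln (1 + exp (\<beta> * x)) / \<beta>)) \<longlongrightarrow> - max 0 x) at_top"
  proof (rule tendsto_minus)
    have bounds: "max 0 x \<le> ln (1 + exp (\<beta> * x)) / \<beta> \<and>
        ln (1 + exp (\<beta> * x)) / \<beta> \<le> max 0 x + ln 2 / \<beta>" if "\<beta> > 0" for \<beta>
    proof -
      have "ln (exp (\<beta> * max 0 x)) \<le> ln (1 + exp (\<beta> * x))"
        by (subst ln_le_cancel_iff) (auto simp: max_def add_pos_pos)
      moreover have "1 + exp (\<beta> * x) \<le> 2 * exp (\<beta> * max 0 x)"
      proof -
        have "1 \<le> exp (\<beta> * max 0 x)" "exp (\<beta> * x) \<le> exp (\<beta> * max 0 x)"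
          using that by auto
        then show ?thesis by linarith
      qed
      then have "ln (1 + exp (\<beta> * x)) \<le> ln (2 * exp (\<beta> * max 0 x))"
        by (subst ln_le_cancel_iff) (auto simp: add_pos_pos)
      then have "ln (1 + exp (\<beta> * x)) \<le> ln 2 + \<beta> * max 0 x"
        by (simp add: ln_mult)
      ultimately have "max 0 x * \<beta> \<le> ln (1 + exp (\<beta> * x))"
        "ln (1 + exp (\<beta> * x)) \<le> (max 0 x + ln 2 / \<beta>) * \<beta>"
        using that by (simp_all add: algebra_simps)
      then show ?thesis
        using pos_le_divide_eq[OF that] pos_divide_le_eq[OF that] by blast
    qed
    have "((\<lambda>\<beta>::real. max 0 x + ln 2 / \<beta>) \<longlongrightarrow> max 0 x + 0) at_top"
      by (intro tendsto_intros tendsto_divide_0[OF tendsto_const]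
          filterlim_at_top_imp_at_infinity filterlim_ident)
    then have upper: "((\<lambda>\<beta>::real. max 0 x + ln 2 / \<beta>) \<longlongrightarrow> max 0 x) at_top" by simp
    show "((\<lambda>\<beta>. ln (1 + exp (\<beta> * x)) / \<beta>) \<longlongrightarrow> max 0 x) at_top"
    proof (rule tendsto_sandwich[OF _ _ tendsto_const upper])
      show "\<forall>\<^sub>F \<beta> in at_top. max 0 x \<le> ln (1 + exp (\<beta> * x)) / \<beta>"
        using eventually_gt_at_top[of 0] by eventually_elim (use bounds in blast)
      show "\<forall>\<^sub>F \<beta> in at_top. ln (1 + exp (\<beta> * x)) / \<beta> \<le> max 0 x + ln 2 / \<beta>"
        using eventually_gt_at_top[of 0] by eventually_elim (use bounds in blast)
    qed
  qed
  moreover have "ln (site_prob L h \<beta> \<sigma> i a) / \<beta> = - (ln (1 + exp (\<beta> * x)) / \<beta>)" for \<beta>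
  proof -
    have "site_prob L h \<beta> \<sigma> i a = inverse (1 + exp (\<beta> * x))"
      by (simp add: site_prob_def x_def inverse_eq_divide mult.assoc mult.left_commute)
    then show ?thesis by (simp add: ln_inverse)
  qed
  ultimately show ?thesis by (simp add: x_def)
qed

lemma energy_cost_eq:
  assumes "\<eta> \<in> configs L"
  shows "((\<lambda>\<beta>. - (ln (trans_prob L h \<beta> \<sigma> \<eta>) / \<beta>)) \<longlongrightarrow> energy_cost L h \<sigma> \<eta>) at_top"
    and "energy_cost L h \<sigma> \<eta> =
      (\<Sum>i | i \<in> torus L \<and> \<eta> i * (local_field L \<sigma> i + h) < 0. 2 * \<bar>local_field L \<sigma> i + h\<bar>)"
      (is "_ = ?E")
proof -
  have "((\<lambda>\<beta>. \<Sum>i\<in>torus L. ln (site_prob L h \<beta> \<sigma> i (\<eta> i)) / \<beta>) \<longlongrightarrow>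
      (\<Sum>i\<in>torus L. - max 0 (- 2 * \<eta> i * (local_field L \<sigma> i + h)))) at_top"
    by (intro tendsto_sum ln_site_prob_tendsto)
  also have "(\<lambda>\<beta>. \<Sum>i\<in>torus L. ln (site_prob L h \<beta> \<sigma> i (\<eta> i)) / \<beta>) =
      (\<lambda>\<beta>. ln (trans_prob L h \<beta> \<sigma> \<eta>) / \<beta>)"
    by (simp add: trans_prob_def ln_prod site_prob_pos[THEN less_imp_neq, symmetric] sum_divide_distrib)
  also have "(\<Sum>i\<in>torus L. - max 0 (- 2 * \<eta> i * (local_field L \<sigma> i + h))) = - ?E"
  proof -
    have "max 0 (- 2 * \<eta> i * (local_field L \<sigma> i + h)) =
        (if \<eta> i * (local_field L \<sigma> i + h) < 0 then 2 * \<bar>local_field L \<sigma> i + h\<bar> else 0)"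
      if "i \<in> torus L" for i
    proof -
      have "\<eta> i = -1 \<or> \<eta> i = 1" using PiE_mem[OF assms[unfolded configs_def] that] by simp
      then show ?thesis by (auto simp: max_def abs_if)
    qed
    then have "(\<Sum>i\<in>torus L. - max 0 (- 2 * \<eta> i * (local_field L \<sigma> i + h))) =
      - (\<Sum>i\<in>torus L. if \<eta> i * (local_field L \<sigma> i + h) < 0 then 2 * \<bar>local_field L \<sigma> i + h\<bar> else 0)"
      by (simp add: sum_negf)
    also have "\<dots> = - ?E" by (simp add: sum.If_cases Int_def)
    finally show ?thesis .
  qed
  finally have lim: "((\<lambda>\<beta>. ln (trans_prob L h \<beta> \<sigma> \<eta>) / \<beta>) \<longlongrightarrow> - ?E) at_top" .
  then have "Lim at_top (\<lambda>\<beta>. ln (trans_prob L h \<beta> \<sigma> \<eta>) / \<beta>) = - ?E"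
    by (intro tendsto_Lim) auto
  then show "energy_cost L h \<sigma> \<eta> = ?E" by (simp add: energy_cost_def)
  with tendsto_minus[OF lim]
  show "((\<lambda>\<beta>. - (ln (trans_prob L h \<beta> \<sigma> \<eta>) / \<beta>)) \<longlongrightarrow> energy_cost L h \<sigma> \<eta>) at_top" by simp
qed

end

theory Submission
  imports Defs
begin

text \<open>With \<open>H(\<sigma>,\<eta>) = - h \<Sum>\<^sub>i (\<sigma>\<^sub>i + \<eta>\<^sub>i) - \<Sum>\<^sub>i \<eta>\<^sub>i S\<^sub>\<sigma>(i)\<close>, which is symmetric, the chain is reversible with conductances
  exactly \<open>exp (- \<beta> H(\<sigma>,\<eta>))\<close>, and the reversible measure is \<open>exp (- \<beta> H(\<sigma>))\<close> up to a bounded factor. Killing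
  the chain started at \<open>\<eta>\<close> when the energy drops below \<open>H(\<eta>)\<close>, reversibility bounds its mean lifetime
  by a constant times the mean number of visits to \<open>\<eta>\<close>, and a path of height \<open>H(\<eta>) + V\<close> to a lower
  configuration bounds the latter by a constant times \<open>exp (\<beta> V)\<close> through the Dirichlet form. Hence within a
  time of that order the energy drops with probability at least \<open>1/2\<close>; iterating over the finitely many
  energies and then over exponentially many blocks of time gives a doubly exponential tail.

  For the second claim one needs paths of height \<open>\<Gamma>\<close> out of the three metastable configurations.
  As \<open>L\<close> is even, the dynamics splits into two independent Ising dynamics, and in each of the metastable
  configurations one of the two copies is all minus and the other constant. Growing a square droplet
  site by site in the former costs at most \<open>max\<^sub>l (8 l - 2 h (l\<^sup>2 - l + 1)) = \<Gamma>\<close>.\<close>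

section \<open>Finite reversible chains\<close>

locale reversible_chain =
  fixes X :: "'a set" and p :: "'a \<Rightarrow> 'a \<Rightarrow> real" and \<mu> :: "'a \<Rightarrow> real"
  assumes finite_X [simp, intro]: "finite X"
    and p_nonneg: "\<And>x y. x \<in> X \<Longrightarrow> y \<in> X \<Longrightarrow> 0 \<le> p x y"
    and p_sum: "\<And>x. x \<in> X \<Longrightarrow> (\<Sum>y\<in>X. p x y) = 1"
    and \<mu>_pos: "\<And>x. x \<in> X \<Longrightarrow> 0 < \<mu> x"
    and reversible: "\<And>x y. x \<in> X \<Longrightarrow> y \<in> X \<Longrightarrow> \<mu> x * p x y = \<mu> y * p y x"
begin

section \<open>The chain absorbed in \<open>B\<close> and its survival probabilities\<close>

definition killed :: "'a set \<Rightarrow> ('a \<Rightarrow> real) \<Rightarrow> 'a \<Rightarrow> real" where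
  "killed B f x = (if x \<in> X - B then \<Sum>y\<in>X - B. p x y * f y else 0)"

text \<open>The probability that the chain stays outside \<open>B\<close> at all of the times 0,
  ..., \<open>n\<close>, the starting time included.\<close>

definition survival :: "'a set \<Rightarrow> nat \<Rightarrow> 'a \<Rightarrow> real" where
  "survival B n = (killed B ^^ n) (indicator (X - B))"

lemma survival_0: "survival B 0 = indicator (X - B)"
  and survival_Suc: "survival B (Suc n) = killed B (survival B n)"
  by (simp_all add: survival_def)

lemma killed_eq_0 [simp]: "x \<notin> X - B \<Longrightarrow> killed B f x = 0"
  unfolding killed_def by (rule if_not_P)

lemma killed_funpow_eq_0: "(\<And>x. x \<notin> X - B \<Longrightarrow> f x = 0) \<Longrightarrow> x \<notin> X - B \<Longrightarrow> (killed B ^^ n) f x = 0"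
  by (cases n) auto

lemma survival_eq_0 [simp]: "x \<notin> X - B \<Longrightarrow> survival B n x = 0"
  unfolding survival_def by (rule killed_funpow_eq_0) auto

lemma killed_mono: "(\<And>y. y \<in> X - B \<Longrightarrow> f y \<le> g y) \<Longrightarrow> killed B f x \<le> killed B g x"
  by (auto simp: killed_def intro!: sum_mono mult_left_mono p_nonneg)

lemma killed_nonneg: "(\<And>y. y \<in> X - B \<Longrightarrow> 0 \<le> f y) \<Longrightarrow> 0 \<le> killed B f x"
  by (auto simp: killed_def intro!: sum_nonneg mult_nonneg_nonneg p_nonneg)

lemma killed_sum: "killed B (\<lambda>x. \<Sum>k\<in>I. f k x) x = (\<Sum>k\<in>I. killed B (f k) x)"
  by (auto simp: killed_def sum_distrib_left intro: sum.swap)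

lemma killed_le_const:
  assumes "\<And>y. y \<in> X - B \<Longrightarrow> f y \<le> c" "0 \<le> c"
  shows "killed B f x \<le> c"
proof (cases "x \<in> X - B")
  case True
  have "killed B f x \<le> (\<Sum>y\<in>X - B. p x y * c)"
    using True assms by (auto simp: killed_def intro!: sum_mono mult_left_mono p_nonneg)
  also have "\<dots> \<le> (\<Sum>y\<in>X. p x y * c)"
    using True assms by (intro sum_mono2) (auto intro!: mult_nonneg_nonneg p_nonneg)
  also have "\<dots> = c" using True p_sum[of x] by (simp flip: sum_distrib_right)
  finally show ?thesis .
qed (use assms in auto)

lemma killed_eq_sum:
  assumes "x \<in> X - B" "\<And>y. y \<notin> X - B \<Longrightarrow> f y = 0"
  shows "killed B f x = (\<Sum>y\<in>X. p x y * f y)"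
  using assms by (auto simp: killed_def intro!: sum.mono_neutral_left)

lemma survival_le_1: "survival B n x \<le> 1"
  by (induction n arbitrary: x) (auto simp: survival_0 survival_Suc indicator_def intro: killed_le_const)

lemma survival_Suc_le: "survival B (Suc n) x \<le> survival B n x"
proof (induction n arbitrary: x)
  case 0
  show ?case using survival_le_1[of B "Suc 0" x] survival_eq_0[of x B "Suc 0"]
    by (cases "x \<in> X - B") (auto simp: survival_0)
next
  case (Suc n)
  then show ?case by (subst (1 2) survival_Suc) (rule killed_mono)
qed

lemma survival_antimono: "m \<le> n \<Longrightarrow> survival B n x \<le> survival B m x"
  by (rule lift_Suc_antimono_le[of "\<lambda>n. survival B n x"]) (rule survival_Suc_le)

section \<open>Self-adjointness and the Dirichlet form\<close>

lemma killed_adjoint: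
  "(\<Sum>x\<in>X. \<mu> x * (killed B f x * g x)) = (\<Sum>x\<in>X. \<mu> x * (f x * killed B g x))"
proof -
  have "(\<Sum>x\<in>X. \<mu> x * (killed B f x * g x)) = (\<Sum>x\<in>X - B. \<Sum>y\<in>X - B. \<mu> x * p x y * f y * g x)"
    by (subst sum.mono_neutral_right[of X "X - B"])
       (auto simp: killed_def sum_distrib_left sum_distrib_right mult_ac)
  also have "\<dots> = (\<Sum>y\<in>X - B. \<Sum>x\<in>X - B. \<mu> x * p x y * f y * g x)" by (rule sum.swap)
  also have "\<dots> = (\<Sum>y\<in>X - B. \<Sum>x\<in>X - B. \<mu> y * p y x * f y * g x)"
    using reversible by (intro sum.cong refl) auto
  also have "\<dots> = (\<Sum>x\<in>X. \<mu> x * (f x * killed B g x))"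
    by (subst sum.mono_neutral_right[of X "X - B"])
       (auto simp: killed_def sum_distrib_left sum_distrib_right mult_ac)
  finally show ?thesis .
qed

lemma killed_funpow_adjoint:
  "(\<Sum>x\<in>X. \<mu> x * ((killed B ^^ n) f x * g x)) = (\<Sum>x\<in>X. \<mu> x * (f x * (killed B ^^ n) g x))"
proof (induction n arbitrary: g)
  case (Suc n)
  have "(\<Sum>x\<in>X. \<mu> x * ((killed B ^^ Suc n) f x * g x)) =
      (\<Sum>x\<in>X. \<mu> x * ((killed B ^^ n) f x * killed B g x))"
    by (simp add: killed_adjoint)
  also have "\<dots> = (\<Sum>x\<in>X. \<mu> x * (f x * (killed B ^^ Suc n) g x))"
    by (subst Suc.IH) (simp add: funpow_Suc_right del: funpow.simps)
  finally show ?case .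
qed simp

text \<open>Since \<open>g\<close> vanishes off \<open>X - B\<close>, killing can be replaced by the
  full matrix \<open>p\<close>, whose rows sum to 1; expanding the square then gives the energy of a
  network with conductances \<open>\<mu> x * p x y\<close>. The factor 2 reflects that ordered pairs
  count edges twice.\<close>

lemma dirichlet_form:
  assumes g: "\<And>x. x \<notin> X - B \<Longrightarrow> g x = 0"
  shows "2 * (\<Sum>x\<in>X. \<mu> x * (g x * (g x - killed B g x))) =
    (\<Sum>x\<in>X. \<Sum>y\<in>X. \<mu> x * p x y * (g x - g y)\<^sup>2)"
proof -
  have "(\<Sum>x\<in>X. \<mu> x * (g x * (g x - killed B g x))) =
      (\<Sum>x\<in>X. \<Sum>y\<in>X. \<mu> x * p x y * (g x)\<^sup>2 - \<mu> x * p x y * (g x * g y))"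
  proof (rule sum.cong[OF refl])
    fix x assume x: "x \<in> X"
    have "g x * (g x - killed B g x) = g x * (\<Sum>y\<in>X. p x y * g x - p x y * g y)"
    proof (cases "x \<in> X - B")
      case True
      then show ?thesis using killed_eq_sum[OF True g] p_sum[OF x]
        by (simp add: sum_subtractf flip: sum_distrib_right)
    qed (use g in auto)
    then have "\<mu> x * (g x * (g x - killed B g x)) =
        (\<Sum>y\<in>X. \<mu> x * (g x * (p x y * g x - p x y * g y)))"
      by (simp only: sum_distrib_left)
    then show "\<mu> x * (g x * (g x - killed B g x)) =
        (\<Sum>y\<in>X. \<mu> x * p x y * (g x)\<^sup>2 - \<mu> x * p x y * (g x * g y))"
      by (simp add: power2_eq_square right_diff_distrib mult_ac)
  qed
  also have "\<dots> = (\<Sum>x\<in>X. \<Sum>y\<in>X. \<mu> x * p x y * (g x)\<^sup>2) - (\<Sum>x\<in>X. \<Sum>y\<in>X. \<mu> x * p x y * (g x * g y))"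
    by (simp add: sum_subtractf)
  finally have *: "(\<Sum>x\<in>X. \<mu> x * (g x * (g x - killed B g x))) = \<dots>" .
  \<comment> \<open>Reversibility makes the two square terms of the expansion equal.\<close>
  have "(\<Sum>x\<in>X. \<Sum>y\<in>X. \<mu> x * p x y * (g y)\<^sup>2) = (\<Sum>y\<in>X. \<Sum>x\<in>X. \<mu> x * p x y * (g y)\<^sup>2)"
    by (rule sum.swap)
  also have "\<dots> = (\<Sum>x\<in>X. \<Sum>y\<in>X. \<mu> x * p x y * (g x)\<^sup>2)"
    using reversible by (intro sum.cong refl) auto
  finally have sym: "(\<Sum>x\<in>X. \<Sum>y\<in>X. \<mu> x * p x y * (g y)\<^sup>2) = (\<Sum>x\<in>X. \<Sum>y\<in>X. \<mu> x * p x y * (g x)\<^sup>2)" .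
  have "(\<Sum>x\<in>X. \<Sum>y\<in>X. \<mu> x * p x y * (g x - g y)\<^sup>2) =
    (\<Sum>x\<in>X. \<Sum>y\<in>X. \<mu> x * p x y * (g x)\<^sup>2) + (\<Sum>x\<in>X. \<Sum>y\<in>X. \<mu> x * p x y * (g y)\<^sup>2)
     - 2 * (\<Sum>x\<in>X. \<Sum>y\<in>X. \<mu> x * p x y * (g x * g y))"
    by (simp add: power2_diff algebra_simps sum.distrib sum_subtractf sum_distrib_left)
  then show ?thesis using * sym by simp
qed

lemma dirichlet_form_edge:
  assumes g: "\<And>x. x \<notin> X - B \<Longrightarrow> g x = 0" and xy: "x \<in> X" "y \<in> X"
  shows "\<mu> x * p x y * (g x - g y)\<^sup>2 \<le> 2 * (\<Sum>x\<in>X. \<mu> x * (g x * (g x - killed B g x)))"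
proof -
  have nn: "0 \<le> \<mu> a * p a b * (g a - g b)\<^sup>2" if "a \<in> X" "b \<in> X" for a b
    using that \<mu>_pos[of a] p_nonneg[of a b] by auto
  have "\<mu> x * p x y * (g x - g y)\<^sup>2 \<le> (\<Sum>b\<in>X. \<mu> x * p x b * (g x - g b)\<^sup>2)"
    using xy nn by (intro member_le_sum) auto
  also have "\<dots> \<le> (\<Sum>a\<in>X. \<Sum>b\<in>X. \<mu> a * p a b * (g a - g b)\<^sup>2)"
    using xy nn by (intro member_le_sum[of x X "\<lambda>a. \<Sum>b\<in>X. \<mu> a * p a b * (g a - g b)\<^sup>2"]) (auto intro!: sum_nonneg)
  finally show ?thesis using dirichlet_form[OF g] by simp
qed

section \<open>The Green function and mean lifetimes\<close>

text \<open>For \<open>z\<close> outside \<open>B\<close>, the mean number of visits to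
  \<open>z\<close> before time \<open>N\<close> of the absorbed chain started at \<open>x\<close>.
  The finite horizon avoids infinite sums, at the price of inequalities in place of
  equalities.\<close>

definition green :: "'a set \<Rightarrow> 'a \<Rightarrow> nat \<Rightarrow> 'a \<Rightarrow> real" where
  "green B z N x = (\<Sum>k<N. (killed B ^^ k) (indicator {z}) x)"

lemma killed_funpow_nonneg: "(\<And>x. 0 \<le> f x) \<Longrightarrow> 0 \<le> (killed B ^^ n) f x"
  by (induction n arbitrary: x) (auto intro: killed_nonneg)

lemma green_nonneg: "0 \<le> green B z N x"
  by (auto simp: green_def intro!: sum_nonneg killed_funpow_nonneg)

lemma green_eq_0: "z \<in> X - B \<Longrightarrow> x \<notin> X - B \<Longrightarrow> green B z N x = 0"
  unfolding green_def
  by (intro sum.neutral ballI killed_funpow_eq_0) (auto simp: indicator_def)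

lemma green_Suc: "green B z (Suc N) x = indicator {z} x + killed B (green B z N) x"
  unfolding green_def killed_sum by (subst sum.lessThan_Suc_shift) simp

text \<open>Maximum principle: from \<open>x \<noteq> z\<close> one step leads to a sub-average of
  values with a shorter horizon, each bounded by the diagonal value.\<close>

lemma green_le_diag: "green B z N x \<le> green B z N z"
proof (induction N arbitrary: x)
  case (Suc N)
  show ?case
  proof (cases "x = z")
    case False
    have "green B z (Suc N) x = killed B (green B z N) x"
      using False by (simp add: green_Suc)
    also have "\<dots> \<le> green B z N z" using Suc green_nonneg by (intro killed_le_const)
    also have "\<dots> \<le> green B z (Suc N) z"
      using killed_funpow_nonneg[of "indicator {z}" N B z] by (simp add: green_def)
    finally show ?thesis .
  qed simp
qed (simp add: green_def)

text \<open>The Green function increases with \<open>N\<close>, so by \<open>green_Suc\<close> it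
  exceeds its killed image by at most the indicator of \<open>z\<close>; pairing with the
  nonnegative Green function leaves only the term at \<open>z\<close>.\<close>

lemma green_dirichlet_le:
  assumes z: "z \<in> X - B"
  shows "(\<Sum>x\<in>X. \<mu> x * (green B z N x * (green B z N x - killed B (green B z N) x))) \<le> \<mu> z * green B z N z"
proof -
  have "(\<Sum>x\<in>X. \<mu> x * (green B z N x * (green B z N x - killed B (green B z N) x)))
      \<le> (\<Sum>x\<in>X. if x = z then \<mu> z * green B z N z else 0)"
  proof (rule sum_mono)
    fix x assume x: "x \<in> X"
    have "green B z N x \<le> green B z (Suc N) x"
      using killed_funpow_nonneg[of "indicator {z}" N B x] by (simp add: green_def)
    then have "green B z N x - killed B (green B z N) x \<le> indicator {z} x"
      by (simp add: green_Suc)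
    then have "\<mu> x * (green B z N x * (green B z N x - killed B (green B z N) x))
        \<le> \<mu> x * (green B z N x * indicator {z} x)"
      using \<mu>_pos[OF x] green_nonneg by (intro mult_left_mono) auto
    then show "\<mu> x * (green B z N x * (green B z N x - killed B (green B z N) x))
        \<le> (if x = z then \<mu> z * green B z N z else 0)"
      by (auto split: if_splits)
  qed
  also have "\<dots> = \<mu> z * green B z N z" using z by simp
  finally show ?thesis .
qed

lemma relpow_abs_diff_le:
  fixes g :: "'a \<Rightarrow> real"
  assumes "\<And>x y. (x, y) \<in> R \<Longrightarrow> \<bar>g x - g y\<bar> \<le> d" "(z, w) \<in> R ^^ n"
  shows "\<bar>g z - g w\<bar> \<le> real n * d"
  using assms(2)
proof (induction n arbitrary: w)
  case (Suc n)
  then obtain v where "(z, v) \<in> R ^^ n" "(v, w) \<in> R" by auto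
  with Suc.IH[of v] assms(1)[of v w] show ?case by (simp add: algebra_simps)
qed simp

text \<open>The effective resistance between \<open>z\<close> and \<open>B\<close> is at most the resistance of a path.\<close>

lemma green_diag_le:
  assumes z: "z \<in> X - B" and w: "w \<in> B" and path: "(z, w) \<in> R ^^ n"
    and R: "R \<subseteq> {(x, y). x \<in> X \<and> y \<in> X \<and> c \<le> \<mu> x * p x y}" and c: "0 < c"
  shows "green B z N z \<le> 2 * (real n)\<^sup>2 * \<mu> z / c"
proof -
  let ?g = "green B z N"
  \<comment> \<open>Each edge of \<open>R\<close> has conductance at least \<open>c\<close> and the
    Dirichlet energy of \<open>?g\<close> is at most \<open>\<mu> z * ?g z\<close>, so no increment
    along the path exceeds \<open>d\<close>.\<close>
  define d where "d = sqrt (2 * \<mu> z * ?g z / c)"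
  have "\<bar>?g x - ?g y\<bar> \<le> d" if "(x, y) \<in> R" for x y
  proof -
    have xy: "x \<in> X" "y \<in> X" "c \<le> \<mu> x * p x y" using that R by auto
    have "c * (?g x - ?g y)\<^sup>2 \<le> \<mu> x * p x y * (?g x - ?g y)\<^sup>2"
      using xy by (intro mult_right_mono) auto
    also have "\<dots> \<le> 2 * (\<Sum>x\<in>X. \<mu> x * (?g x * (?g x - killed B ?g x)))"
      using green_eq_0[OF z] xy by (intro dirichlet_form_edge) auto
    also have "\<dots> \<le> 2 * (\<mu> z * ?g z)"
      using green_dirichlet_le[OF z, of N] by linarith
    finally have "(?g x - ?g y)\<^sup>2 \<le> 2 * \<mu> z * ?g z / c"
      using c by (simp add: field_simps)
    then show ?thesis unfolding d_def by (intro real_le_rsqrt) simp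
  qed
  from relpow_abs_diff_le[of R ?g d, OF this path] have "?g z \<le> real n * d"
    using green_eq_0[OF z, of w N] w by simp
  then have "(?g z)\<^sup>2 \<le> (real n * d)\<^sup>2" using green_nonneg by (intro power_mono) auto
  also have "\<dots> = (real n)\<^sup>2 * (2 * \<mu> z * ?g z / c)"
    using z \<mu>_pos[of z] green_nonneg[of B z N z] c by (simp add: d_def power_mult_distrib)
  \<comment> \<open>Quadratic on the left, linear on the right: one factor \<open>?g z\<close>
    cancels, and the case \<open>?g z = 0\<close> is trivial.\<close>
  finally have "?g z * ?g z \<le> (2 * (real n)\<^sup>2 * \<mu> z / c) * ?g z"
    by (simp add: power2_eq_square mult_ac)
  moreover have "0 \<le> 2 * (real n)\<^sup>2 * \<mu> z / c" using z \<mu>_pos[of z] c by auto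
  ultimately show ?thesis using green_nonneg[of B z N z]
    by (metis mult_right_le_imp_le order_le_less)
qed

text \<open>Survival decreases in time, so \<open>N\<close> times its last value is at most the
  truncated mean lifetime. Time reversal turns this lifetime, weighted by \<open>\<mu> z\<close>,
  into visits to \<open>z\<close> from all starting points, which the diagonal Green function
  controls.\<close>

lemma survival_le:
  fixes r :: real
  assumes z: "z \<in> X - B" and w: "w \<in> B" and path: "(z, w) \<in> R ^^ n"
    and R: "R \<subseteq> {(x, y). x \<in> X \<and> y \<in> X \<and> c \<le> \<mu> x * p x y}" and c: "0 < c"
    and r: "\<And>x. x \<in> X - B \<Longrightarrow> \<mu> x \<le> r * \<mu> z"
  shows "real N * survival B N z \<le> real (card X) * r * (2 * (real n)\<^sup>2 * \<mu> z / c)"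
proof -
  have rpos: "0 \<le> r" using r[OF z] \<mu>_pos[of z] z by (simp add: zero_le_mult_iff)
  have "real N * survival B N z \<le> (\<Sum>k<N. survival B k z)"
    using sum_mono[of "{..<N}" "\<lambda>_. survival B N z" "\<lambda>k. survival B k z"] survival_antimono by auto
  then have "\<mu> z * (real N * survival B N z) \<le> \<mu> z * (\<Sum>k<N. survival B k z)"
    using \<mu>_pos[of z] z by (intro mult_left_mono) auto
  also have "\<dots> = (\<Sum>k<N. \<Sum>x\<in>X. \<mu> x * (indicator {z} x * survival B k x))"
    using z by (auto simp: sum_distrib_left indicator_def of_bool_def if_distrib if_distribR
        sum.delta cong: if_cong)
  \<comment> \<open>Time reversal: adjointness moves the killed steps from the survival function
    onto the indicator of \<open>z\<close>.\<close>
  also have "\<dots> = (\<Sum>k<N. \<Sum>x\<in>X. \<mu> x * ((killed B ^^ k) (indicator {z}) x * indicator (X - B) x))"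
    unfolding survival_def by (simp add: killed_funpow_adjoint)
  also have "\<dots> = (\<Sum>x\<in>X. \<mu> x * (green B z N x * indicator (X - B) x))"
    by (subst sum.swap) (simp only: green_def sum_distrib_left sum_distrib_right)
  also have "\<dots> \<le> (\<Sum>x\<in>X. r * \<mu> z * green B z N z)"
  proof (rule sum_mono)
    fix x assume x: "x \<in> X"
    have "0 \<le> r * \<mu> z * green B z N z" using rpos \<mu>_pos[of z] z green_nonneg by auto
    moreover have "\<mu> x * green B z N x \<le> r * \<mu> z * green B z N z" if "x \<in> X - B"
      using r[OF that] green_le_diag green_nonneg rpos \<mu>_pos[of z] z by (intro mult_mono) auto
    ultimately show "\<mu> x * (green B z N x * indicator (X - B) x) \<le> r * \<mu> z * green B z N z"
      by (auto split: split_indicator)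
  qed
  also have "\<dots> = \<mu> z * (real (card X) * r * green B z N z)" by simp
  finally have "real N * survival B N z \<le> real (card X) * r * green B z N z"
    using \<mu>_pos[of z] z by simp
  also have "\<dots> \<le> real (card X) * r * (2 * (real n)\<^sup>2 * \<mu> z / c)"
    using green_diag_le[OF z w path R c] rpos by (intro mult_left_mono) auto
  finally show ?thesis .
qed

section \<open>Iteration over hitting times and blocks of time\<close>

text \<open>The Markov property at the hitting time of \<open>B\<close>.\<close>

lemma survival_add_le:
  assumes "A \<subseteq> B" and M: "\<And>y. y \<in> X \<inter> B \<Longrightarrow> survival A s y \<le> M" "0 \<le> M" "M \<le> 1"
  shows "survival A (t + s) x \<le> survival B t x + (1 - survival B t x) * M"
proof (cases "x \<in> X")
  case False
  then show ?thesis using M by simp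
next
  case True
  then show ?thesis
  proof (induction t arbitrary: x)
    case 0
    then show ?case using M survival_le_1[of A s x]
      by (cases "x \<in> B") (auto simp: survival_0)
  next
    case (Suc t)
    show ?case
    proof (cases "x \<in> B")
      case True
      then have "survival A s x \<le> M" using M Suc.prems by auto
      then show ?thesis
        using True survival_antimono[of s "Suc t + s" A x] by auto
    next
      case False
      then have x: "x \<in> X - B" "x \<in> X - A" using assms Suc.prems by auto
      have "survival A (Suc t + s) x = (\<Sum>y\<in>X. p x y * survival A (t + s) y)"
        unfolding add_Suc survival_Suc by (rule killed_eq_sum[OF x(2) survival_eq_0])
      also have "\<dots> \<le> (\<Sum>y\<in>X. p x y * (survival B t y + (1 - survival B t y) * M))"
        using x by (intro sum_mono mult_left_mono Suc.IH p_nonneg) auto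
      \<comment> \<open>The bound is affine in \<open>survival B t y\<close>, hence preserved by
        averaging over one step.\<close>
      also have "\<dots> = (\<Sum>y\<in>X. p x y * survival B t y) * (1 - M) + (\<Sum>y\<in>X. p x y) * M"
        by (simp add: algebra_simps sum.distrib sum_subtractf sum_distrib_left)
      also have "(\<Sum>y\<in>X. p x y * survival B t y) = survival B (Suc t) x"
        unfolding survival_Suc by (rule killed_eq_sum[OF x(1) survival_eq_0, symmetric])
      also have "survival B (Suc t) x * (1 - M) + (\<Sum>y\<in>X. p x y) * M =
          survival B (Suc t) x + (1 - survival B (Suc t) x) * M"
        using x by (simp add: p_sum left_diff_distrib right_diff_distrib)
      finally show ?thesis .
    qed
  qed
qed

text \<open>As \<open>q\<close> is uniform in the starting point, the Markov property at the
  multiples of \<open>s\<close> yields one factor \<open>q\<close> per block.\<close>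

lemma survival_mult_le:
  assumes "\<And>x. x \<in> X \<Longrightarrow> survival A s x \<le> q" "0 \<le> q"
  shows "survival A (k * s) x \<le> q ^ k"
proof (induction k arbitrary: x)
  case 0
  then show ?case using survival_le_1 by simp
next
  case (Suc k)
  have "survival A (s + k * s) x \<le> survival A s x * q ^ k" for x
  proof -
    have "survival A (t + k * s) x \<le> survival A t x * q ^ k" for t
    proof (induction t arbitrary: x)
      case 0
      show ?case using Suc[of x] by (cases "x \<in> X - A") (auto simp: survival_0)
    next
      case (Suc t)
      have "survival A (Suc t + k * s) x \<le> killed A (\<lambda>y. survival A t y * q ^ k) x"
        using Suc by (auto simp: survival_Suc intro!: killed_mono)
      also have "\<dots> = survival A (Suc t) x * q ^ k"
        by (simp add: survival_Suc killed_def sum_distrib_right mult.assoc)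
      finally show ?case .
    qed
    then show ?thesis .
  qed
  also have "survival A s x * q ^ k \<le> q * q ^ k" for x
    using assms by (cases "x \<in> X") (auto intro!: mult_right_mono)
  finally show ?case by simp
qed

text \<open>Each stage of length \<open>t\<close> lowers the energy or reaches \<open>A\<close> with
  probability at least 1/2. At most \<open>card X\<close> stages are possible, and at a state of
  least energy the stage must reach \<open>A\<close>.\<close>

lemma survival_descent:
  fixes E :: "'a \<Rightarrow> real"
  assumes half: "\<And>x. x \<in> X - A \<Longrightarrow> survival ({y \<in> X. E y < E x} \<union> A) t x \<le> 1/2"
    and x: "x \<in> X"
  shows "survival A (card X * t) x \<le> 1 - (1/2) ^ card X"
proof -
  let ?I = "\<lambda>x. {y \<in> X. E y < E x}"
  \<comment> \<open>The induction is on a strict bound \<open>m\<close> for the number of states of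
    lower energy, which shrinks at every drop.\<close>
  have "survival A (m * t) x \<le> 1 - (1/2) ^ m" if "x \<in> X" "card (?I x) < m" for x m
    using that
  proof (induction m arbitrary: x)
    case (Suc m)
    show ?case
    proof (cases "x \<in> A")
      case True
      then show ?thesis by (auto intro: power_le_one order_trans[OF power_le_one])
    next
      case False
      let ?B = "?I x \<union> A" and ?M = "1 - (1/2) ^ m :: real"
      have "survival A (m * t) y \<le> ?M" if "y \<in> X \<inter> ?B" for y
      proof (cases "y \<in> A")
        case False
        then have y: "y \<in> X" "E y < E x" using that by auto
        then have "card (?I y) < card (?I x)" by (intro psubset_card_mono) auto
        then show ?thesis using Suc y by auto
      qed (auto intro: power_le_one order_trans[OF power_le_one])
      then have "survival A (t + m * t) x \<le> survival ?B t x + (1 - survival ?B t x) * ?M"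
        by (intro survival_add_le) (auto intro: power_le_one order_trans[OF power_le_one])
      also have "\<dots> = 1 - (1 - survival ?B t x) * (1/2) ^ m" by (simp add: algebra_simps)
      also have "\<dots> \<le> 1 - (1/2) * (1/2) ^ m"
        using half[of x] False Suc.prems by (auto intro!: mult_right_mono)
      finally show ?thesis by simp
    qed
  qed simp
  moreover have "card (?I x) < card X" using x by (intro psubset_card_mono) auto
  ultimately show ?thesis using x by auto
qed

end

section \<open>Tails of the hitting times\<close>

definition pair_energy :: "nat \<Rightarrow> real \<Rightarrow> config \<Rightarrow> config \<Rightarrow> real" where
  "pair_energy L h \<sigma> \<eta> = (\<Sum>i\<in>torus L. - h * (\<sigma> i + \<eta> i) - \<eta> i * local_field L \<sigma> i)"

text \<open>An unnormalised reversible measure: the second factor, twice a hyperbolic cosine, is the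
  normalising constant of \<open>site_prob\<close>.\<close>

definition weight :: "nat \<Rightarrow> real \<Rightarrow> real \<Rightarrow> config \<Rightarrow> real" where
  "weight L h \<beta> \<sigma> = (\<Prod>i\<in>torus L. exp (\<beta> * h * \<sigma> i) *
     (exp (\<beta> * (local_field L \<sigma> i + h)) + exp (- (\<beta> * (local_field L \<sigma> i + h)))))"

lemma configs_cases: "\<sigma> \<in> configs L \<Longrightarrow> i \<in> torus L \<Longrightarrow> \<sigma> i = -1 \<or> \<sigma> i = 1"
  by (auto simp: configs_def dest: PiE_mem)

lemma torus_dist_commute: "torus_dist L i j = torus_dist L j i"
  by (simp add: torus_dist_def cyclic_dist_def abs_minus_commute)

lemma local_field_eq_sum:
  "local_field L \<sigma> i = (\<Sum>j\<in>torus L. if torus_dist L i j = 1 then \<sigma> j else 0)"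
  by (simp add: local_field_def sum.If_cases Int_def)

lemma pair_energy_commute: "pair_energy L h \<sigma> \<eta> = pair_energy L h \<eta> \<sigma>"
proof -
  have "(\<Sum>i\<in>torus L. \<eta> i * local_field L \<sigma> i) = (\<Sum>i\<in>torus L. \<sigma> i * local_field L \<eta> i)"
    unfolding local_field_eq_sum sum_distrib_left
    by (subst sum.swap) (auto intro!: sum.cong simp: torus_dist_commute)
  then show ?thesis by (simp add: pair_energy_def sum_subtractf add.commute)
qed

text \<open>Site by site, minus the modulus of the field plus the cost of disobeying it equals minus
  the spin times the field.\<close>

lemma transition_energy_eq_pair_energy:
  assumes "\<eta> \<in> configs L"
  shows "transition_energy L h \<sigma> \<eta> = pair_energy L h \<sigma> \<eta>"
proof -
  have "transition_energy L h \<sigma> \<eta> = (\<Sum>i\<in>torus L. - h * \<sigma> i - \<bar>local_field L \<sigma> i + h\<bar>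
      + (if \<eta> i * (local_field L \<sigma> i + h) < 0 then 2 * \<bar>local_field L \<sigma> i + h\<bar> else 0))"
    unfolding transition_energy_def energy_cost_eq(2)[OF assms] virtual_energy_def
    by (simp add: sum.distrib sum_subtractf sum_distrib_left sum.If_cases Int_def sum_negf)
  also have "\<dots> = pair_energy L h \<sigma> \<eta>"
    unfolding pair_energy_def
  proof (rule sum.cong[OF refl])
    fix i assume "i \<in> torus L"
    from configs_cases[OF assms this]
    show "- h * \<sigma> i - \<bar>local_field L \<sigma> i + h\<bar>
      + (if \<eta> i * (local_field L \<sigma> i + h) < 0 then 2 * \<bar>local_field L \<sigma> i + h\<bar> else 0)
      = - h * (\<sigma> i + \<eta> i) - \<eta> i * local_field L \<sigma> i"
      by (auto simp: abs_if algebra_simps)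
  qed
  finally show ?thesis .
qed

lemma virtual_energy_eq_sum:
  "virtual_energy L h \<sigma> = (\<Sum>i\<in>torus L. - h * \<sigma> i - \<bar>local_field L \<sigma> i + h\<bar>)"
  by (simp add: virtual_energy_def sum_subtractf sum_distrib_left sum_negf)

lemma virtual_energy_le_pair_energy:
  assumes "\<eta> \<in> configs L"
  shows "virtual_energy L h \<sigma> \<le> pair_energy L h \<sigma> \<eta>"
  unfolding virtual_energy_eq_sum pair_energy_def
proof (rule sum_mono)
  fix i assume "i \<in> torus L"
  from configs_cases[OF assms this]
  show "- h * \<sigma> i - \<bar>local_field L \<sigma> i + h\<bar> \<le> - h * (\<sigma> i + \<eta> i) - \<eta> i * local_field L \<sigma> i"
    by (auto simp: abs_if algebra_simps)
qed

text \<open>The normalising constants cancel. With \<open>pair_energy_commute\<close> this is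
  detailed balance.\<close>

lemma weight_trans_prob:
  assumes "\<eta> \<in> configs L"
  shows "weight L h \<beta> \<sigma> * trans_prob L h \<beta> \<sigma> \<eta> = exp (- \<beta> * pair_energy L h \<sigma> \<eta>)"
proof -
  have "weight L h \<beta> \<sigma> * trans_prob L h \<beta> \<sigma> \<eta> =
    (\<Prod>i\<in>torus L. exp (\<beta> * (h * (\<sigma> i + \<eta> i) + \<eta> i * local_field L \<sigma> i)))"
    unfolding weight_def trans_prob_def prod.distrib[symmetric]
  proof (rule prod.cong[OF refl])
    fix i assume i: "i \<in> torus L"
    define x where "x = \<beta> * (local_field L \<sigma> i + h)"
    have "exp x * (1 + exp (- 2 * x)) = exp x + exp (- x)"
      and "exp (- x) * (1 + exp (2 * x)) = exp x + exp (- x)"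
      by (simp_all add: distrib_left flip: exp_add)
    then have "(exp x + exp (- x)) / (1 + exp (- 2 * \<eta> i * x)) = exp (\<eta> i * x)"
      using configs_cases[OF assms i] by (auto simp: field_simps add_pos_pos less_imp_neq[symmetric])
    moreover have "- 2 * \<beta> * \<eta> i * (local_field L \<sigma> i + h) = - 2 * \<eta> i * x"
      by (simp add: x_def)
    ultimately have "(exp x + exp (- x)) * site_prob L h \<beta> \<sigma> i (\<eta> i) = exp (\<eta> i * x)"
      unfolding site_prob_def by (simp only: times_divide_eq_right mult_1_right)
    then have "exp (\<beta> * h * \<sigma> i) * (exp x + exp (- x)) * site_prob L h \<beta> \<sigma> i (\<eta> i) =
        exp (\<beta> * h * \<sigma> i) * exp (\<eta> i * x)" by simp
    also have "\<dots> = exp (\<beta> * (h * (\<sigma> i + \<eta> i) + \<eta> i * local_field L \<sigma> i))"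
      by (simp add: x_def algebra_simps flip: exp_add)
    finally show "exp (\<beta> * h * \<sigma> i) * (exp (\<beta> * (local_field L \<sigma> i + h)) +
        exp (- (\<beta> * (local_field L \<sigma> i + h)))) * site_prob L h \<beta> \<sigma> i (\<eta> i) = \<dots>"
      by (simp add: x_def)
  qed
  also have "\<dots> = exp (\<Sum>i\<in>torus L. \<beta> * (h * (\<sigma> i + \<eta> i) + \<eta> i * local_field L \<sigma> i))"
    by (simp add: exp_sum)
  also have "(\<Sum>i\<in>torus L. \<beta> * (h * (\<sigma> i + \<eta> i) + \<eta> i * local_field L \<sigma> i)) = - \<beta> * pair_energy L h \<sigma> \<eta>"
    by (simp add: pair_energy_def sum_distrib_left algebra_simps)
  finally show ?thesis .
qed

lemma weight_pos: "0 < weight L h \<beta> \<sigma>"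
  by (auto simp: weight_def intro!: prod_pos mult_pos_pos add_pos_pos)

lemma exp_virtual_energy:
  "exp (- \<beta> * virtual_energy L h \<sigma>) =
    (\<Prod>i\<in>torus L. exp (\<beta> * h * \<sigma> i) * exp (\<beta> * \<bar>local_field L \<sigma> i + h\<bar>))"
  by (simp add: virtual_energy_eq_sum sum_distrib_left exp_sum algebra_simps flip: exp_add)

text \<open>Twice the hyperbolic cosine lies between the exponential of the modulus and its double,
  which costs one factor 2 per site.\<close>

lemma weight_bounds:
  assumes "0 \<le> \<beta>"
  shows "exp (- \<beta> * virtual_energy L h \<sigma>) \<le> weight L h \<beta> \<sigma>"
    and "weight L h \<beta> \<sigma> \<le> 2 ^ card (torus L) * exp (- \<beta> * virtual_energy L h \<sigma>)"
proof -
  have *: "exp (\<beta> * \<bar>x\<bar>) \<le> exp (\<beta> * x) + exp (- (\<beta> * x))"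
    "exp (\<beta> * x) + exp (- (\<beta> * x)) \<le> 2 * exp (\<beta> * \<bar>x\<bar>)" for x
  proof -
    have "exp (\<beta> * x) \<le> exp (\<beta> * \<bar>x\<bar>)" "exp (- (\<beta> * x)) \<le> exp (\<beta> * \<bar>x\<bar>)"
      using mult_left_mono[OF _ assms, of x "\<bar>x\<bar>"] mult_left_mono[OF _ assms, of "- x" "\<bar>x\<bar>"] by auto
    then show "exp (\<beta> * x) + exp (- (\<beta> * x)) \<le> 2 * exp (\<beta> * \<bar>x\<bar>)" by linarith
    show "exp (\<beta> * \<bar>x\<bar>) \<le> exp (\<beta> * x) + exp (- (\<beta> * x))"
      by (auto simp: abs_if add_increasing add_increasing2)
  qed
  show "exp (- \<beta> * virtual_energy L h \<sigma>) \<le> weight L h \<beta> \<sigma>"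
    unfolding exp_virtual_energy weight_def
    by (intro prod_mono conjI mult_left_mono * mult_nonneg_nonneg) auto
  have "weight L h \<beta> \<sigma> \<le> (\<Prod>i\<in>torus L. exp (\<beta> * h * \<sigma> i) * (2 * exp (\<beta> * \<bar>local_field L \<sigma> i + h\<bar>)))"
    unfolding weight_def
    by (intro prod_mono conjI mult_left_mono * mult_nonneg_nonneg add_nonneg_nonneg) auto
  also have "\<dots> = 2 ^ card (torus L) * exp (- \<beta> * virtual_energy L h \<sigma>)"
    unfolding exp_virtual_energy by (simp add: prod.distrib mult_ac)
  finally show "weight L h \<beta> \<sigma> \<le> 2 ^ card (torus L) * exp (- \<beta> * virtual_energy L h \<sigma>)" .
qed

interpretation pca: reversible_chain "configs L" "trans_prob L h \<beta>" "weight L h \<beta>"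
  for L :: nat and h \<beta> :: real
  by unfold_locales
     (auto simp: sum_trans_prob weight_pos weight_trans_prob pair_energy_commute intro: less_imp_le[OF trans_prob_pos])

section \<open>From the trajectory law to survival probabilities\<close>

text \<open>Unlike in \<open>survival\<close>, the starting point is not tested: hitting times are positive.\<close>

primrec avoid :: "nat \<Rightarrow> real \<Rightarrow> real \<Rightarrow> config set \<Rightarrow> nat \<Rightarrow> config \<Rightarrow> real" where
  "avoid L h \<beta> A 0 \<sigma> = 1"
| "avoid L h \<beta> A (Suc n) \<sigma> = (\<Sum>\<eta>\<in>configs L - A. trans_prob L h \<beta> \<sigma> \<eta> * avoid L h \<beta> A n \<eta>)"

lemma avoid_eq_survival:
  "\<sigma> \<in> configs L - A \<Longrightarrow> avoid L h \<beta> A n \<sigma> = pca.survival L h \<beta> A n \<sigma>"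
  by (induction n arbitrary: \<sigma>) (auto simp: pca.survival_0 pca.survival_Suc pca.killed_def)

lemma sets_chain_law_coordinate:
  assumes \<eta>: "\<eta> \<in> configs L"
  shows "{\<omega> \<in> space (chain_law L h \<beta> \<eta>). P (\<omega> t)} \<in> sets (chain_law L h \<beta> \<eta>)"
proof -
  have "(\<lambda>\<omega>. \<omega> t) \<in> chain_law L h \<beta> \<eta> \<rightarrow>\<^sub>M count_space (configs L)"
    unfolding measurable_cong_sets[OF prob_space_chain_law(2)[OF \<eta>] refl]
    by (rule measurable_component_singleton) simp
  from measurable_sets[OF this, of "{x \<in> configs L. P x}"] show ?thesis
    using prob_space_chain_law(3)[OF \<eta>]
    by (auto simp: vimage_def Int_def conj_commute PiE_iff cong: conj_cong)
qed

text \<open>Freezing a prefix of the trajectory makes induction on \<open>n\<close> possible: the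
  event is split by the state at time \<open>Suc m\<close>, and the base case is the cylinder
  formula.\<close>

lemma measure_chain_law_avoid:
  assumes \<eta>: "\<eta> \<in> configs L" and s: "\<And>k. s k \<in> configs L"
  shows "measure (chain_law L h \<beta> \<eta>) {\<omega> \<in> space (chain_law L h \<beta> \<eta>).
      (\<forall>k\<le>m. \<omega> k = s k) \<and> (\<forall>t. m < t \<and> t \<le> m + n \<longrightarrow> \<omega> t \<notin> A)} =
    (if s 0 = \<eta> then \<Prod>k<m. trans_prob L h \<beta> (s k) (s (Suc k)) else 0) * avoid L h \<beta> A n (s m)"
  using s
proof (induction n arbitrary: m s)
  case 0
  have "measure (chain_law L h \<beta> \<eta>) {\<omega> \<in> space (chain_law L h \<beta> \<eta>). \<forall>k\<le>m. \<omega> k = s k} =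
    (if s 0 = \<eta> then \<Prod>k<m. trans_prob L h \<beta> (s k) (s (Suc k)) else 0)"
    unfolding measure_def using emeasure_chain_law_cylinder[OF \<eta> 0, of h \<beta> m]
    by (simp add: prod_nonneg less_imp_le[OF trans_prob_pos])
  moreover have "(\<forall>t. m < t \<and> t \<le> m + 0 \<longrightarrow> \<omega> t \<notin> A) = True" for \<omega> :: "nat \<Rightarrow> config" by auto
  ultimately show ?case unfolding avoid.simps mult_1_right by presburger
next
  case (Suc n)
  let ?M = "chain_law L h \<beta> \<eta>"
  interpret prob_space ?M by (rule prob_space_chain_law[OF \<eta>])
  let ?E = "\<lambda>m s n. {\<omega> \<in> space ?M. (\<forall>k\<le>m. \<omega> k = s k) \<and> (\<forall>t. m < t \<and> t \<le> m + n \<longrightarrow> \<omega> t \<notin> A)}"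
  let ?s = "\<lambda>y. s(Suc m := y)"
  have sets: "?E m s n \<in> sets ?M" for m s n
    by (intro sets.sets_Collect_conj sets.sets_Collect_countable_All sets.sets_Collect_imp
        sets.sets_Collect_const sets_chain_law_coordinate[OF \<eta>])
  have "?E m s (Suc n) = (\<Union>y\<in>configs L - A. ?E (Suc m) (?s y) n)"
  proof (intro set_eqI iffI)
    fix \<omega> assume \<omega>: "\<omega> \<in> ?E m s (Suc n)"
    then have "\<omega> (Suc m) \<in> configs L - A"
      using prob_space_chain_law(3)[OF \<eta>] by auto
    moreover have "\<omega> \<in> ?E (Suc m) (?s (\<omega> (Suc m))) n" using \<omega> by (auto simp: le_Suc_eq)
    ultimately show "\<omega> \<in> (\<Union>y\<in>configs L - A. ?E (Suc m) (?s y) n)" by blast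
  next
    fix \<omega> assume "\<omega> \<in> (\<Union>y\<in>configs L - A. ?E (Suc m) (?s y) n)"
    then obtain y where y: "y \<in> configs L - A" "\<omega> \<in> ?E (Suc m) (?s y) n" by blast
    from y have "\<omega> (Suc m) = y" by auto
    moreover have "\<omega> k = s k" if "k \<le> m" for k using y that by (auto dest: spec[of _ k])
    moreover have "\<omega> t \<notin> A" if "m < t" "t \<le> m + Suc n" for t
      using y that \<open>\<omega> (Suc m) = y\<close> by (cases "t = Suc m") auto
    ultimately show "\<omega> \<in> ?E m s (Suc n)" using y by auto
  qed
  then have "measure ?M (?E m s (Suc n)) = measure ?M (\<Union>y\<in>configs L - A. ?E (Suc m) (?s y) n)"
    by simp
  also have "\<dots> = (\<Sum>y\<in>configs L - A. measure ?M (?E (Suc m) (?s y) n))"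
  proof (rule finite_measure_finite_Union)
    show "disjoint_family_on (\<lambda>y. ?E (Suc m) (?s y) n) (configs L - A)"
      by (auto simp: disjoint_family_on_def dest!: spec[of _ "Suc m"])
    show "(\<lambda>y. ?E (Suc m) (?s y) n) ` (configs L - A) \<subseteq> sets ?M"
      by (rule image_subsetI) (rule sets)
  qed simp
  also have "\<dots> = (\<Sum>y\<in>configs L - A.
      (if s 0 = \<eta> then \<Prod>k<m. trans_prob L h \<beta> (s k) (s (Suc k)) else 0) *
      (trans_prob L h \<beta> (s m) y * avoid L h \<beta> A n y))"
  proof (rule sum.cong[OF refl])
    fix y assume "y \<in> configs L - A"
    then have "?s y k \<in> configs L" for k using Suc.prems by auto
    note Suc.IH[of "?s y" "Suc m", OF this]
    moreover have "(\<Prod>k<Suc m. trans_prob L h \<beta> (?s y k) (?s y (Suc k))) =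
      (\<Prod>k<m. trans_prob L h \<beta> (s k) (s (Suc k))) * trans_prob L h \<beta> (s m) y"
      by (simp add: prod.lessThan_Suc)
    ultimately show "measure ?M (?E (Suc m) (?s y) n) =
      (if s 0 = \<eta> then \<Prod>k<m. trans_prob L h \<beta> (s k) (s (Suc k)) else 0) *
      (trans_prob L h \<beta> (s m) y * avoid L h \<beta> A n y)" by simp
  qed
  finally show ?case by (simp add: sum_distrib_left)
qed

text \<open>Time 0 is not tested, so one step is spent before \<open>survival\<close> applies; it
  then tests the times 1 to \<open>Suc n\<close>.\<close>

lemma prob_hitting_gt_le:
  assumes \<eta>: "\<eta> \<in> configs L" and n: "real (Suc n) \<le> T"
    and q: "\<And>\<sigma>. \<sigma> \<in> configs L \<Longrightarrow> pca.survival L h \<beta> A n \<sigma> \<le> q" "0 \<le> q"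
  shows "prob_hitting_gt L h \<beta> \<eta> A T \<le> q"
proof -
  let ?M = "chain_law L h \<beta> \<eta>"
  interpret prob_space ?M by (rule prob_space_chain_law[OF \<eta>])
  let ?E = "{\<omega> \<in> space ?M. (\<forall>k\<le>0. \<omega> k = \<eta>) \<and> (\<forall>t. 0 < t \<and> t \<le> 0 + Suc n \<longrightarrow> \<omega> t \<notin> A)}"
  let ?H = "{\<omega> \<in> space ?M. ereal T < ereal_of_enat (hitting_time A \<omega>)}"
  let ?F = "{\<omega> \<in> space ?M. (\<forall>k\<le>0. \<omega> k = \<eta>) \<and> (\<forall>t. 0 < t \<and> t \<le> 0 + 0 \<longrightarrow> \<omega> t \<notin> A)}"
  \<comment> \<open>Trajectories with another starting point form a null set, so the event lies in
    \<open>?E\<close> only almost surely.\<close>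
  have F: "measure ?M ?F = 1"
    using measure_chain_law_avoid[of \<eta> L "\<lambda>_. \<eta>" h \<beta> 0 0 A] \<eta> by simp
  have AE: "AE \<omega> in ?M. \<omega> 0 = \<eta>"
    using AE_prob_1[OF F] by eventually_elim auto
  have E: "?E \<in> sets ?M"
    by (intro sets.sets_Collect_conj sets.sets_Collect_countable_All sets.sets_Collect_imp
        sets.sets_Collect_const sets_chain_law_coordinate[OF \<eta>])
  have "measure ?M ?H \<le> measure ?M ?E"
  proof (rule finite_measure_mono_AE[OF _ E])
    show "AE \<omega> in ?M. \<omega> \<in> ?H \<longrightarrow> \<omega> \<in> ?E"
      using AE
    proof eventually_elim
      case (elim \<omega>)
      have "\<omega> t \<notin> A" if "ereal T < ereal_of_enat (hitting_time A \<omega>)" "0 < t" "t \<le> Suc n" for t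
      proof
        assume "\<omega> t \<in> A"
        then have "hitting_time A \<omega> \<le> enat t"
          using that unfolding hitting_time_def by (intro Inf_lower) auto
        then have "ereal_of_enat (hitting_time A \<omega>) \<le> ereal_of_enat (enat t)"
          by (subst ereal_of_enat_le_iff)
        also have "\<dots> \<le> ereal T" using that n by simp
        finally show False using that by simp
      qed
      then show ?case using elim by auto
    qed
  qed
  also have "\<dots> = (\<Sum>\<sigma>\<in>configs L - A. trans_prob L h \<beta> \<eta> \<sigma> * avoid L h \<beta> A n \<sigma>)"
    using measure_chain_law_avoid[of \<eta> L "\<lambda>_. \<eta>" h \<beta> 0 "Suc n" A] \<eta> by simp
  also have "\<dots> \<le> (\<Sum>\<sigma>\<in>configs L - A. trans_prob L h \<beta> \<eta> \<sigma> * q)"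
    using q by (intro sum_mono mult_left_mono) (auto simp: avoid_eq_survival less_imp_le[OF trans_prob_pos])
  also have "\<dots> \<le> (\<Sum>\<sigma>\<in>configs L. trans_prob L h \<beta> \<eta> \<sigma> * q)"
    using q by (intro sum_mono2) (auto simp: less_imp_le[OF trans_prob_pos])
  also have "\<dots> = q" by (simp add: sum_trans_prob flip: sum_distrib_right)
  finally show ?thesis by (simp add: prob_hitting_gt_def)
qed

section \<open>Paths of bounded height and the descent of energy\<close>

definition low_edges :: "nat \<Rightarrow> real \<Rightarrow> real \<Rightarrow> (config \<times> config) set" where
  "low_edges L h E = {(\<sigma>, \<eta>). \<sigma> \<in> configs L \<and> \<eta> \<in> configs L \<and> pair_energy L h \<sigma> \<eta> \<le> E}"

text \<open>The reachability form of a bound \<open>V\<close> on the stability level. By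
  \<open>weight_trans_prob\<close>, low edges are edges of large conductance, as
  \<open>pca.survival_le\<close> requires.\<close>

definition descends :: "nat \<Rightarrow> real \<Rightarrow> real \<Rightarrow> config \<Rightarrow> bool" where
  "descends L h V \<sigma> \<longleftrightarrow> (\<exists>\<eta>\<in>configs L. virtual_energy L h \<eta> < virtual_energy L h \<sigma> \<and>
     (\<sigma>, \<eta>) \<in> (low_edges L h (virtual_energy L h \<sigma> + V))\<^sup>*)"

text \<open>Strict descent forces a first edge out of \<sigma>, and no such edge lies below the
  virtual energy of \<sigma>.\<close>

lemma descends_nonneg:
  assumes "descends L h V \<sigma>" shows "0 \<le> V"
proof -
  from assms obtain \<eta> where \<eta>: "virtual_energy L h \<eta> < virtual_energy L h \<sigma>"
    "(\<sigma>, \<eta>) \<in> (low_edges L h (virtual_energy L h \<sigma> + V))\<^sup>*"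
    by (auto simp: descends_def)
  from this(2) show ?thesis
  proof (cases rule: converse_rtranclE)
    case base
    with \<eta> show ?thesis by simp
  next
    case (step \<zeta>)
    then show ?thesis using virtual_energy_le_pair_energy[of \<zeta> L h \<sigma>] by (auto simp: low_edges_def)
  qed
qed

text \<open>The gap between \<open>V\<close> and \<open>V'\<close> replaces the infimum by an actual
  path; an empty set of lower configurations would make the stability level infinite.\<close>

lemma stability_level_imp_descends:
  assumes \<sigma>: "\<sigma> \<in> configs L" and V: "stability_level L h \<sigma> \<le> ereal V" and V': "V < V'"
  shows "descends L h V' \<sigma>"
proof -
  let ?E = "virtual_energy L h \<sigma> + V'"
  have "comm_height_sets L h {\<sigma>} (lower_energy_set L h \<sigma>) < ereal ?E"
  proof (rule ccontr)
    assume "\<not> ?thesis"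
    then have "ereal ?E \<le> comm_height_sets L h {\<sigma>} (lower_energy_set L h \<sigma>)" by simp
    then have "ereal ?E - ereal (virtual_energy L h \<sigma>) \<le> stability_level L h \<sigma>"
      unfolding stability_level_def by (rule ereal_minus_mono) simp
    also note V
    finally show False using V' by simp
  qed
  then obtain \<eta> \<omega> where \<eta>: "\<eta> \<in> lower_energy_set L h \<sigma>" and \<omega>: "is_path L \<omega>" "hd \<omega> = \<sigma>" "last \<omega> = \<eta>"
    and height: "path_height L h \<omega> < ?E"
    by (auto simp: comm_height_sets_def comm_height_def Inf_less_iff INF_less_iff)
  have ne: "\<omega> \<noteq> []" using \<omega> by (auto simp: is_path_def)
  have edge: "(\<omega> ! i, \<omega> ! Suc i) \<in> low_edges L h ?E" if "Suc i < length \<omega>" for i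
  proof -
    have in_X: "\<omega> ! i \<in> configs L" "\<omega> ! Suc i \<in> configs L"
      using that \<omega>(1) nth_mem[of i \<omega>] nth_mem[of "Suc i" \<omega>] by (auto simp: is_path_def)
    have "transition_energy L h (\<omega> ! i) (\<omega> ! (i + 1)) \<le>
      Max ((\<lambda>i. transition_energy L h (\<omega> ! i) (\<omega> ! (i + 1))) ` {0..<length \<omega> - 1})"
      using that by (intro Max_ge) auto
    also have "\<dots> = path_height L h \<omega>" using that by (simp add: path_height_def)
    finally show ?thesis
      using height in_X by (simp add: low_edges_def transition_energy_eq_pair_energy)
  qed
  have "(\<omega> ! 0, \<omega> ! i) \<in> (low_edges L h ?E)\<^sup>*" if "i < length \<omega>" for i
    using that
  proof (induction i)
    case (Suc i)
    then show ?case using edge[of i] by (auto intro: rtrancl_into_rtrancl)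
  qed simp
  from this[of "length \<omega> - 1"] have "(\<sigma>, \<eta>) \<in> (low_edges L h ?E)\<^sup>*"
    using ne \<omega> by (simp add: hd_conv_nth last_conv_nth)
  then show ?thesis using \<eta> by (auto simp: descends_def lower_energy_set_def)
qed

lemma survival_half:
  fixes L :: nat and h \<beta> V :: real
  defines "M \<equiv> card (configs L \<times> configs L)" and "D \<equiv> 2 ^ card (torus L) :: real"
  assumes \<beta>: "0 \<le> \<beta>" and \<sigma>: "\<sigma> \<in> configs L - A" and desc: "descends L h V \<sigma>"
    and t: "4 * real (card (configs L)) * D\<^sup>2 * (real M)\<^sup>2 * exp (\<beta> * V) \<le> real t"
  shows "pca.survival L h \<beta> ({\<eta> \<in> configs L. virtual_energy L h \<eta> < virtual_energy L h \<sigma>} \<union> A) t \<sigma> \<le> 1/2"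
proof -
  let ?H = "virtual_energy L h" and ?w = "weight L h \<beta>"
  let ?R = "low_edges L h (?H \<sigma> + V)" and ?c = "exp (- \<beta> * (?H \<sigma> + V))"
  let ?B = "{\<eta> \<in> configs L. ?H \<eta> < ?H \<sigma>} \<union> A"
  from desc obtain \<eta> where \<eta>: "\<eta> \<in> configs L" "?H \<eta> < ?H \<sigma>" and path: "(\<sigma>, \<eta>) \<in> ?R\<^sup>*"
    by (auto simp: descends_def)
  have R: "?R \<subseteq> configs L \<times> configs L" by (auto simp: low_edges_def)
  then have fin: "finite ?R" by (rule finite_subset) simp
  \<comment> \<open>Finiteness of the edge set bounds the path length independently of
    \<beta>.\<close>
  obtain n where n: "n \<le> card ?R" "(\<sigma>, \<eta>) \<in> ?R ^^ n"
    using path unfolding rtrancl_finite_eq_relpow[OF fin] by auto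
  have "n \<le> M" using n card_mono[OF _ R] unfolding M_def by simp
  have z: "\<sigma> \<in> configs L - ?B" using \<sigma> by auto
  have "real t * pca.survival L h \<beta> ?B t \<sigma> \<le>
      real (card (configs L)) * D * (2 * (real n)\<^sup>2 * ?w \<sigma> / ?c)"
  proof (rule pca.survival_le[OF z _ n(2)])
    show "\<eta> \<in> ?B" using \<eta> by auto
    show "?R \<subseteq> {(x, y). x \<in> configs L \<and> y \<in> configs L \<and> ?c \<le> ?w x * trans_prob L h \<beta> x y}"
      using \<beta> by (auto simp: low_edges_def weight_trans_prob intro!: mult_left_mono)
    \<comment> \<open>Outside \<open>?B\<close> no energy is below that of \<sigma>, so the weights
      there exceed \<open>?w \<sigma>\<close> by at most the factor \<open>D\<close>.\<close>
    fix x assume x: "x \<in> configs L - ?B"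
    have "?w x \<le> D * exp (- \<beta> * ?H x)" unfolding D_def by (rule weight_bounds[OF \<beta>])
    also have "\<dots> \<le> D * exp (- \<beta> * ?H \<sigma>)"
      using x \<beta> by (auto simp: D_def intro!: mult_left_mono)
    also have "\<dots> \<le> D * ?w \<sigma>" unfolding D_def by (intro mult_left_mono weight_bounds[OF \<beta>]) auto
    finally show "?w x \<le> D * ?w \<sigma>" .
  qed auto
  also have "\<dots> \<le> real (card (configs L)) * D * (2 * (real M)\<^sup>2 * (D * exp (- \<beta> * ?H \<sigma>)) / ?c)"
    using \<open>n \<le> M\<close> weight_bounds(2)[OF \<beta>, of L h \<sigma>] weight_pos[of L h \<beta> \<sigma>]
    unfolding D_def
    by (intro mult_left_mono divide_right_mono mult_mono power_mono) auto
  also have "exp (- \<beta> * ?H \<sigma>) / ?c = exp (\<beta> * V)"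
    by (simp add: algebra_simps flip: exp_diff)
  then have "real (card (configs L)) * D * (2 * (real M)\<^sup>2 * (D * exp (- \<beta> * ?H \<sigma>)) / ?c) =
     (4 * real (card (configs L)) * D\<^sup>2 * (real M)\<^sup>2 * exp (\<beta> * V)) / 2"
    by (simp add: power2_eq_square flip: times_divide_eq_right)
  also have "\<dots> \<le> real t / 2" by (rule divide_right_mono[OF t]) simp
  finally have *: "real t * pca.survival L h \<beta> ?B t \<sigma> \<le> real t * (1 / 2)" by simp
  have "0 < card (configs L)" by (simp add: card_gt_0_iff)
  then have "0 < 4 * real (card (configs L)) * D\<^sup>2 * (real M)\<^sup>2 * exp (\<beta> * V)"
    by (simp add: M_def D_def card_cartesian_product)
  with t have "0 < real t" by linarith
  with * show ?thesis by (simp only: mult_le_cancel_left_pos)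
qed

section \<open>Doubly exponential tails\<close>

lemma SES_of_power_bound:
  fixes f :: "real \<Rightarrow> real"
  assumes "0 < q" "q < 1" "0 < \<delta>"
    and bound: "\<forall>\<^sub>F \<beta> in at_top. 0 \<le> f \<beta> \<and> f \<beta> \<le> q ^ nat \<lfloor>exp (\<beta> * \<delta>)\<rfloor>"
  shows "SES f"
  unfolding SES_def tendsto_MInfty
proof
  fix r :: real
  define a where "a = - ln q"
  have a: "0 < a" using assms by (simp add: a_def)
  \<comment> \<open>The threshold makes \<open>a * (\<beta> * \<delta>)\<^sup>2 / 2\<close> at least
    \<open>(\<bar>r\<bar> + 1) * \<beta>\<close>.\<close>
  have "\<forall>\<^sub>F \<beta> in at_top. max 1 (2 * (\<bar>r\<bar> + 1) / (a * \<delta>\<^sup>2)) \<le> \<beta>" by (rule eventually_ge_at_top)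
  with bound show "\<forall>\<^sub>F \<beta> in at_top. (if f \<beta> = 0 then - \<infinity> else ereal (1 / \<beta> * ln (f \<beta>))) < ereal r"
  proof eventually_elim
    case (elim \<beta>)
    then have \<beta>: "1 \<le> \<beta>" "2 * (\<bar>r\<bar> + 1) / (a * \<delta>\<^sup>2) \<le> \<beta>" by auto
    let ?k = "nat \<lfloor>exp (\<beta> * \<delta>)\<rfloor>"
    show ?case
    proof (cases "f \<beta> = 0")
      case False
      then have f: "0 < f \<beta>" "f \<beta> \<le> q ^ ?k" using elim by auto
      have k: "(\<beta> * \<delta>)\<^sup>2 / 2 \<le> real ?k"
      proof -
        \<comment> \<open>A quadratic bound on the exponential is enough; its constant term pays for
          the rounding in \<open>?k\<close>.\<close>
        have "1 + \<beta> * \<delta> + (\<beta> * \<delta>)\<^sup>2 / 2 \<le> exp (\<beta> * \<delta>)"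
          using exp_lower_Taylor_quadratic[of "\<beta> * \<delta>"] \<beta> assms by simp
        moreover have "exp (\<beta> * \<delta>) < real ?k + 1" by linarith
        moreover have "0 \<le> \<beta> * \<delta>" using \<beta> assms by simp
        ultimately show ?thesis by linarith
      qed
      have "\<bar>r\<bar> + 1 \<le> a * \<delta>\<^sup>2 * \<beta> / 2"
        using \<beta>(2) a assms by (simp add: field_simps)
      then have "(\<bar>r\<bar> + 1) * \<beta> \<le> a * \<delta>\<^sup>2 * \<beta> / 2 * \<beta>" using \<beta> by (intro mult_right_mono) auto
      also have "\<dots> = a * ((\<beta> * \<delta>)\<^sup>2 / 2)" by (simp add: power2_eq_square)
      also have "\<dots> \<le> a * real ?k" using k a by (intro mult_left_mono) auto
      finally have "real ?k * ln q \<le> - ((\<bar>r\<bar> + 1) * \<beta>)" by (simp add: a_def algebra_simps)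
      moreover have "ln (f \<beta>) \<le> ln (q ^ ?k)" using f assms by (subst ln_le_cancel_iff) auto
      ultimately have "ln (f \<beta>) \<le> - ((\<bar>r\<bar> + 1) * \<beta>)"
        unfolding ln_realpow by linarith
      then have "1 / \<beta> * ln (f \<beta>) \<le> - (\<bar>r\<bar> + 1)" using \<beta> by (simp add: field_simps)
      then show ?thesis using False by simp
    qed simp
  qed
qed

text \<open>The available time has room for about \<open>exp (\<beta> * (\<epsilon> / 2))\<close>
  blocks of \<open>m * t\<close> steps, each reaching \<open>A\<close> with probability at least
  \<open>1 - q\<close>; the remaining factor \<open>exp (\<beta> * (\<epsilon> / 2))\<close> absorbs
  the constants.\<close>

lemma SES_hitting_gt:
  assumes desc: "\<And>\<sigma>. \<sigma> \<in> configs L - A \<Longrightarrow> descends L h V \<sigma>" and V: "0 \<le> V" and \<epsilon>: "0 < \<epsilon>"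
  shows "SES (\<lambda>\<beta>. SUP \<eta>\<in>configs L. prob_hitting_gt L h \<beta> \<eta> A (exp (\<beta> * (V + \<epsilon>))))"
proof -
  define m where "m = card (configs L)"
  define C where "C = 4 * real m * (2 ^ card (torus L))\<^sup>2 * (real (card (configs L \<times> configs L)))\<^sup>2"
  define q :: real where "q = 1 - (1/2) ^ m"
  have "0 < m" by (simp add: m_def card_gt_0_iff)
  then have "1/2 \<le> q" "q < 1"
    using power_decreasing[of 1 m "1/2 :: real"] by (auto simp: q_def)
  have C: "0 \<le> C" by (simp add: C_def)
  show ?thesis
  proof (rule SES_of_power_bound[of q "\<epsilon> / 2"])
    \<comment> \<open>Up to the factor \<open>exp (\<beta> * V)\<close>, \<open>b\<close> bounds the
      block length \<open>m * t\<close>. The threshold on \<beta> that follows ensures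
      \<open>b + 1 \<le> ?y\<close>.\<close>
    define b where "b = real m * (C + 1)"
    have b: "0 \<le> b" using C by (simp add: b_def)
    have "\<forall>\<^sub>F \<beta> in at_top. max 0 (2 * b / \<epsilon>) \<le> \<beta>" by (rule eventually_ge_at_top)
    then show "\<forall>\<^sub>F \<beta> in at_top.
      0 \<le> (SUP \<eta>\<in>configs L. prob_hitting_gt L h \<beta> \<eta> A (exp (\<beta> * (V + \<epsilon>)))) \<and>
      (SUP \<eta>\<in>configs L. prob_hitting_gt L h \<beta> \<eta> A (exp (\<beta> * (V + \<epsilon>)))) \<le> q ^ nat \<lfloor>exp (\<beta> * (\<epsilon> / 2))\<rfloor>"
    proof eventually_elim
      case (elim \<beta>)
      then have \<beta>: "0 \<le> \<beta>" "2 * b / \<epsilon> \<le> \<beta>" by auto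
      define t where "t = nat \<lceil>C * exp (\<beta> * V)\<rceil>"
      let ?y = "exp (\<beta> * (\<epsilon> / 2))"
      let ?k = "nat \<lfloor>?y\<rfloor>"
      have survival: "pca.survival L h \<beta> A (?k * (m * t)) \<sigma> \<le> q ^ ?k" for \<sigma>
      proof (rule pca.survival_mult_le)
        fix x assume x: "x \<in> configs L"
        show "pca.survival L h \<beta> A (m * t) x \<le> q"
          unfolding q_def m_def
        proof (rule pca.survival_descent[OF _ x])
          fix \<sigma> assume "\<sigma> \<in> configs L - A"
          then show "pca.survival L h \<beta> ({\<eta> \<in> configs L. virtual_energy L h \<eta> < virtual_energy L h \<sigma>} \<union> A) t \<sigma> \<le> 1/2"
            using \<beta> desc by (intro survival_half) (auto simp: t_def C_def m_def)
        qed
      qed (use \<open>1/2 \<le> q\<close> in simp)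
      have eV: "1 \<le> exp (\<beta> * V)" using \<beta> V by simp
      have "real t \<le> C * exp (\<beta> * V) + 1"
        using C of_int_ceiling_le_add_one[of "C * exp (\<beta> * V)"] by (auto simp: t_def)
      also have "\<dots> \<le> (C + 1) * exp (\<beta> * V)" using eV by (simp add: algebra_simps)
      finally have t: "real t \<le> (C + 1) * exp (\<beta> * V)" .
      have "real (?k * (m * t)) \<le> ?y * (real m * ((C + 1) * exp (\<beta> * V)))"
        using t by (simp only: of_nat_mult) (intro mult_mono, auto)
      also have "\<dots> = ?y * b * exp (\<beta> * V)" by (simp add: b_def)
      finally have n: "real (?k * (m * t)) \<le> ?y * b * exp (\<beta> * V)" .
      have y: "b + 1 \<le> ?y"
      proof -
        have "b \<le> \<beta> * (\<epsilon> / 2)" using \<beta> \<epsilon> by (simp add: field_simps)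
        then show ?thesis using exp_ge_add_one_self[of "\<beta> * (\<epsilon> / 2)"] by linarith
      qed
      \<comment> \<open>The successor is the untested first step of
        \<open>prob_hitting_gt_le\<close>; it is absorbed since \<open>exp (\<beta> * V)\<close> is
        at least 1.\<close>
      have "real (Suc (?k * (m * t))) \<le> (?y * b + 1) * exp (\<beta> * V)"
        using n eV unfolding of_nat_Suc distrib_right mult_1 by linarith
      also have "\<dots> \<le> (?y * ?y) * exp (\<beta> * V)"
      proof (rule mult_right_mono)
        have "?y * b + 1 \<le> ?y * (b + 1)" using y b unfolding distrib_left by linarith
        also have "\<dots> \<le> ?y * ?y" using y by (intro mult_left_mono) auto
        finally show "?y * b + 1 \<le> ?y * ?y" .
      qed simp
      also have "\<dots> = exp (\<beta> * (V + \<epsilon>))" by (simp add: algebra_simps flip: exp_add)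
      finally have T: "real (Suc (?k * (m * t))) \<le> exp (\<beta> * (V + \<epsilon>))" .
      let ?P = "\<lambda>\<eta>. prob_hitting_gt L h \<beta> \<eta> A (exp (\<beta> * (V + \<epsilon>)))"
      have "?P \<eta> \<le> q ^ ?k" if "\<eta> \<in> configs L" for \<eta>
        using survival \<open>1/2 \<le> q\<close> by (intro prob_hitting_gt_le[OF that T]) auto
      then have "(SUP \<eta>\<in>configs L. ?P \<eta>) \<le> q ^ ?k" by (intro cSUP_least) auto
      moreover have "0 \<le> (SUP \<eta>\<in>configs L. ?P \<eta>)"
        by (rule cSUP_upper2[OF _ special_configs(1)[of L]])
           (auto simp: prob_hitting_gt_def)
      ultimately show ?case by simp
    qed
  qed (use \<open>1/2 \<le> q\<close> \<open>q < 1\<close> \<epsilon> in auto)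
qed

section \<open>Growing a droplet\<close>

definition nbrs :: "nat \<Rightarrow> site \<Rightarrow> site set" where
  "nbrs L i = {j \<in> torus L. torus_dist L i j = 1}"

lemma local_field_nbrs: "local_field L \<sigma> i = (\<Sum>j\<in>nbrs L i. \<sigma> j)"
  by (simp add: local_field_def nbrs_def)

lemma nbrs_subset: "nbrs L i \<subseteq> torus L"
  by (auto simp: nbrs_def)

lemma nbrs_in_torus: "j \<in> nbrs L i \<Longrightarrow> j \<in> torus L"
  by (simp add: nbrs_def)

lemma finite_nbrs [simp]: "finite (nbrs L i)"
  using nbrs_subset by (rule finite_subset) simp

lemma nbrs_iff:
  assumes "2 \<le> L" "i \<in> torus L" "j \<in> torus L"
  shows "j \<in> nbrs L i \<longleftrightarrow>
    fst i = fst j \<and> (snd j = (snd i + 1) mod L \<or> snd i = (snd j + 1) mod L) \<or>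
    snd i = snd j \<and> (fst j = (fst i + 1) mod L \<or> fst i = (fst j + 1) mod L)"
proof -
  have "fst i < L" "snd i < L" "fst j < L" "snd j < L" using assms by (auto simp: torus_def)
  then show ?thesis
    using assms by (auto simp: nbrs_def torus_dist_eq_1 cyclic_dist_eq_1)
qed

lemma parity_Suc_mod:
  assumes "even (L :: nat)" shows "even ((a + 1) mod L) \<longleftrightarrow> odd a"
  using assms by (simp add: dvd_mod_iff)

text \<open>An even side length keeps the chessboard colouring consistent across the periodic
  boundary.\<close>

lemma nbrs_parity:
  assumes L: "even L" "2 \<le> L" and "i \<in> torus L" "j \<in> nbrs L i"
  shows "even (fst j + snd j) \<longleftrightarrow> odd (fst i + snd i)"
proof -
  have "j \<in> torus L" using assms nbrs_in_torus by blast
  then show ?thesis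
    using assms parity_Suc_mod[OF L(1), of "fst i"] parity_Suc_mod[OF L(1), of "fst j"]
      parity_Suc_mod[OF L(1), of "snd i"] parity_Suc_mod[OF L(1), of "snd j"]
    by (auto simp: nbrs_iff)
qed

text \<open>Only an upper bound, because opposite neighbours coincide for
  \<open>L = 2\<close>.\<close>

lemma card_nbrs_le:
  assumes L: "2 \<le> L" and i: "i \<in> torus L"
  shows "card (nbrs L i) \<le> 4"
proof -
  let ?p = "\<lambda>a. (a + L - 1) mod L"
  have prev: "b = ?p a" if "a = (b + 1) mod L" "b < L" for a b
    using that L by (cases "b + 1 = L") auto
  have "nbrs L i \<subseteq> set [(fst i, (snd i + 1) mod L), (fst i, ?p (snd i)),
      ((fst i + 1) mod L, snd i), (?p (fst i), snd i)]"
  proof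
    fix j assume j: "j \<in> nbrs L i"
    then have jt: "j \<in> torus L" by (rule nbrs_in_torus)
    then have "fst j < L" "snd j < L" by (auto simp: torus_def)
    with j show "j \<in> set [(fst i, (snd i + 1) mod L), (fst i, ?p (snd i)),
      ((fst i + 1) mod L, snd i), (?p (fst i), snd i)]"
      using prev[of "fst i" "fst j"] prev[of "snd i" "snd j"]
      by (auto simp: nbrs_iff[OF L i jt] prod_eq_iff)
  qed
  then have "card (nbrs L i) \<le> length [(fst i, (snd i + 1) mod L), (fst i, ?p (snd i)),
      ((fst i + 1) mod L, snd i), (?p (fst i), snd i)]"
    by (meson card_length card_mono finite_set order_trans)
  then show ?thesis by simp
qed

lemma nbrs_left: "(Suc a, b) \<in> torus L \<Longrightarrow> (a, b) \<in> nbrs L (Suc a, b)"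
  and nbrs_below: "(a, Suc b) \<in> torus L \<Longrightarrow> (a, b) \<in> nbrs L (a, Suc b)"
  by (auto simp: torus_def nbrs_iff)

lemma card_nbrs_pos:
  assumes L: "2 \<le> L" and i: "i \<in> torus L"
  shows "0 < card (nbrs L i)"
proof -
  have "(fst i, (snd i + 1) mod L) \<in> torus L" using L i by (auto simp: torus_def)
  then have "(fst i, (snd i + 1) mod L) \<in> nbrs L i" using L i by (simp add: nbrs_iff)
  then show ?thesis by (auto simp: card_gt_0_iff)
qed

section \<open>The Ising energy of a plus set\<close>

text \<open>Since \<open>L\<close> is even, \<open>pair_energy\<close> is the sum of two Ising energies: one of the spins of \<open>\<sigma>\<close> at
  even sites and of \<open>\<eta>\<close> at odd sites, the other of the remaining spins. Along
  \<open>half_config\<close> one of these two Ising configurations has plus set \<open>K\<close> and the other is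
  constantly \<open>s\<close>.\<close>

definition half_config :: "nat \<Rightarrow> real \<Rightarrow> bool \<Rightarrow> site set \<Rightarrow> config" where
  "half_config L s b K = restrict (\<lambda>i. if even (fst i + snd i) = b then (if i \<in> K then 1 else -1) else s) (torus L)"

definition droplet_energy :: "nat \<Rightarrow> real \<Rightarrow> real \<Rightarrow> site set \<Rightarrow> real" where
  "droplet_energy L h s K = pair_energy L h (half_config L s True K) (half_config L s False K)"

lemma half_config_apply:
  "i \<in> torus L \<Longrightarrow> half_config L s b K i = (if even (fst i + snd i) = b then (if i \<in> K then 1 else -1) else s)"
  by (simp add: half_config_def)

lemma half_config_in_configs: "s = -1 \<or> s = 1 \<Longrightarrow> half_config L s b K \<in> configs L"
  by (auto simp: configs_def half_config_def)

lemma pair_energy_half_config: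
  "pair_energy L h (half_config L s b K) (half_config L s (\<not> b) K) = droplet_energy L h s K"
  by (cases b) (auto simp: droplet_energy_def pair_energy_commute)

text \<open>A new site is visible in only one of the two half configurations, so a single step out
  of the other one realises the insertion.\<close>

lemma half_config_insert:
  "even (fst x + snd x) \<noteq> b \<Longrightarrow> half_config L s b (insert x K) = half_config L s b K"
  by (auto simp: half_config_def fun_eq_iff restrict_def)

lemma local_field_half_config_same:
  assumes "even L" "2 \<le> L" "i \<in> torus L" "even (fst i + snd i) = b"
  shows "local_field L (half_config L s b K) i = s * card (nbrs L i)"
proof -
  have "local_field L (half_config L s b K) i = (\<Sum>j\<in>nbrs L i. s)"
    unfolding local_field_nbrs
  proof (rule sum.cong[OF refl])
    fix j assume "j \<in> nbrs L i"
    then show "half_config L s b K j = s"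
      using assms nbrs_parity[of L i j] nbrs_in_torus[of j L i] by (auto simp: half_config_def)
  qed
  then show ?thesis by simp
qed

lemma local_field_half_config_diff:
  assumes "even L" "2 \<le> L" "i \<in> torus L" "even (fst i + snd i) \<noteq> b"
  shows "local_field L (half_config L s b K) i = 2 * real (card (nbrs L i \<inter> K)) - real (card (nbrs L i))"
proof -
  have "local_field L (half_config L s b K) i = (\<Sum>j\<in>nbrs L i. 2 * indicator K j - 1)"
    unfolding local_field_nbrs
  proof (rule sum.cong[OF refl])
    fix j assume "j \<in> nbrs L i"
    then show "half_config L s b K j = 2 * indicator K j - 1"
      using assms nbrs_parity[of L i j] nbrs_in_torus[of j L i] by (auto simp: half_config_def)
  qed
  also have "\<dots> = 2 * real (card (nbrs L i \<inter> K)) - real (card (nbrs L i))"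
    by (simp add: sum_subtractf indicator_def of_bool_def sum.If_cases flip: sum_distrib_left)
  finally show ?thesis .
qed

text \<open>With \<open>b\<close> the parity of \<open>x\<close>, only one argument of
  \<open>pair_energy\<close> changes, and only at \<open>x\<close>. The bracket, neighbours outside
  minus neighbours inside, is the change of perimeter.\<close>

lemma droplet_energy_insert:
  assumes "even L" "2 \<le> L" and x: "x \<in> torus L - K"
  shows "droplet_energy L h s (insert x K) = droplet_energy L h s K - 2 * h
    + 2 * (real (card (nbrs L x)) - 2 * real (card (nbrs L x \<inter> K)))"
proof -
  define b where "b = even (fst x + snd x)"
  let ?\<sigma> = "half_config L s b K" and ?\<eta> = "half_config L s (\<not> b) K"
  have \<eta>: "half_config L s (\<not> b) (insert x K) = ?\<eta>"
    by (rule half_config_insert) (simp add: b_def)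
  have \<sigma>: "half_config L s b (insert x K) i = ?\<sigma> i + (if i = x then 2 else 0)" if "i \<in> torus L" for i
    using x that by (auto simp: half_config_def b_def)
  have "droplet_energy L h s (insert x K) = pair_energy L h ?\<eta> (half_config L s b (insert x K))"
    unfolding \<eta>[symmetric] using pair_energy_half_config[of L h s "\<not> b" "insert x K"] by simp
  also have "\<dots> = (\<Sum>i\<in>torus L. - h * (?\<eta> i + ?\<sigma> i) - ?\<sigma> i * local_field L ?\<eta> i
      + (if i = x then - 2 * h - 2 * local_field L ?\<eta> x else 0))"
    unfolding pair_energy_def by (rule sum.cong) (auto simp: \<sigma> algebra_simps)
  also have "\<dots> = pair_energy L h ?\<eta> ?\<sigma> - 2 * h - 2 * local_field L ?\<eta> x"
    using x by (simp add: sum.distrib pair_energy_def)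
  also have "pair_energy L h ?\<eta> ?\<sigma> = droplet_energy L h s K"
    using pair_energy_half_config[of L h s "\<not> b" K] by simp
  also have "local_field L ?\<eta> x = 2 * real (card (nbrs L x \<inter> K)) - real (card (nbrs L x))"
    using assms by (intro local_field_half_config_diff) (auto simp: b_def)
  finally show ?thesis by simp
qed

text \<open>All plus and all minus have the same interaction energy, so each site contributes only
  its field term.\<close>

lemma droplet_energy_torus:
  assumes "even L" "2 \<le> L"
  shows "droplet_energy L h s (torus L) = droplet_energy L h s {} - 2 * h * card (torus L)"
proof -
  have "droplet_energy L h s (torus L) = (\<Sum>i\<in>torus L.
     (- h * (half_config L s True {} i + half_config L s False {} i)
      - half_config L s False {} i * local_field L (half_config L s True {}) i) - 2 * h)"
    unfolding droplet_energy_def pair_energy_def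
  proof (rule sum.cong[OF refl])
    fix i assume i: "i \<in> torus L"
    have "nbrs L i \<inter> torus L = nbrs L i" using nbrs_subset by (rule Int_absorb2)
    then show "- h * (half_config L s True (torus L) i + half_config L s False (torus L) i)
      - half_config L s False (torus L) i * local_field L (half_config L s True (torus L)) i
      = (- h * (half_config L s True {} i + half_config L s False {} i)
      - half_config L s False {} i * local_field L (half_config L s True {}) i) - 2 * h"
      using i assms local_field_half_config_same[of L i True s]
        local_field_half_config_diff[of L i True s "torus L"] local_field_half_config_diff[of L i True s "{}"]
      by (cases "even (fst i + snd i)") (auto simp: half_config_apply algebra_simps)
  qed
  then show ?thesis by (simp add: droplet_energy_def pair_energy_def sum_subtractf)
qed

text \<open>Every site has a neighbour and \<open>h < 1\<close>, so the external field never
  reverses the sign of the local field. Hence the step to the other half configuration obeys the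
  field everywhere and costs nothing.\<close>

lemma virtual_energy_half_config_empty:
  assumes "even L" "2 \<le> L" "0 < h" "h < 1" and s: "s = -1 \<or> s = 1"
  shows "virtual_energy L h (half_config L s b {}) = droplet_energy L h s {}"
  unfolding virtual_energy_eq_sum pair_energy_half_config[symmetric, where b = b] pair_energy_def
proof (rule sum.cong[OF refl])
  fix i assume i: "i \<in> torus L"
  have "1 \<le> real (card (nbrs L i))" using card_nbrs_pos[of L i] assms i by simp
  then show "- h * half_config L s b {} i - \<bar>local_field L (half_config L s b {}) i + h\<bar> =
    - h * (half_config L s b {} i + half_config L s (\<not> b) {} i)
      - half_config L s (\<not> b) {} i * local_field L (half_config L s b {}) i"
    using i assms local_field_half_config_same[of L i b s "{}"] local_field_half_config_diff[of L i b s "{}"]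
    by (cases "even (fst i + snd i) = b") (auto simp: half_config_apply abs_if algebra_simps)
qed

section \<open>Droplet growth up to the critical height\<close>

text \<open>For positive \<open>l\<close> the left side is the energy of an \<open>l\<close> by
  \<open>l - 1\<close> rectangle with one protruding site: perimeter \<open>4 * l\<close>, area
  \<open>l\<^sup>2 - l + 1\<close>. This concave parabola has its vertex at
  \<open>2 / h + 1/2\<close>; the critical length is an integer nearest to it and gives exactly
  \<open>Gamma_PCA h\<close>.\<close>

lemma Gamma_PCA_ge:
  assumes h: "0 < h"
  shows "8 * real l - 2 * h * ((real l)\<^sup>2 - real l + 1) \<le> Gamma_PCA h"
proof -
  define r where "r = real_of_int (critical_length h)"
  have r: "2 / h < r" "r \<le> 2 / h + 1" unfolding r_def critical_length_def by linarith+
  have Gamma: "Gamma_PCA h = - 2 * h * r\<^sup>2 + 2 * r * (4 + h) - 2 * h"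
    by (simp add: Gamma_PCA_def r_def)
  \<comment> \<open>The two zeros in \<open>l\<close> are \<open>r\<close> and its mirror image in
    the vertex. They are at most 1 apart, so no integer lies strictly between them.\<close>
  have eq: "Gamma_PCA h - (8 * real l - 2 * h * ((real l)\<^sup>2 - real l + 1)) =
      2 * h * ((r - real l) * (2 * (2 / h) + 1 - r - real l))"
    unfolding Gamma using h by (simp add: field_simps power2_eq_square)
  have "0 \<le> (r - real l) * (2 * (2 / h) + 1 - r - real l)"
  proof (cases "int l < critical_length h")
    case True
    then have "real l + 1 \<le> r" unfolding r_def by linarith
    then show ?thesis using r by (intro mult_nonneg_nonneg) linarith+
  next
    case False
    then consider "int l = critical_length h" | "critical_length h + 1 \<le> int l" by linarith
    then show ?thesis
    proof cases
      case 1
      then have "real l = r" unfolding r_def by linarith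
      then show ?thesis by simp
    next
      case 2
      then have "r + 1 \<le> real l" unfolding r_def by linarith
      then show ?thesis using r by (intro mult_nonpos_nonpos) linarith+
    qed
  qed
  then show ?thesis using eq h by (smt (verit) mult_nonneg_nonneg)
qed

text \<open>\<open>P\<close> bounds the perimeter of the droplet \<open>K\<close>.\<close>

definition droplet :: "nat \<Rightarrow> real \<Rightarrow> real \<Rightarrow> bool \<Rightarrow> real \<Rightarrow> site set \<Rightarrow> bool" where
  "droplet L h s b\<^sub>0 P K \<longleftrightarrow> K \<subseteq> torus L \<and>
     droplet_energy L h s K \<le> droplet_energy L h s {} + 2 * P - 2 * h * card K \<and>
     (\<forall>b. (half_config L s b\<^sub>0 {}, half_config L s b K) \<in> (low_edges L h (droplet_energy L h s {} + Gamma_PCA h))\<^sup>*)"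

text \<open>With degree at most 4 and \<open>m\<close> neighbours in \<open>K\<close>, the perimeter
  grows by at most \<open>4 - 2 * m\<close>. One new edge is needed, between the half configurations
  without and with \<open>x\<close>, and its height is the energy of the new droplet.\<close>

lemma droplet_insert:
  assumes L: "even L" "2 \<le> L" and s: "s = -1 \<or> s = 1" and K: "droplet L h s b\<^sub>0 P K"
    and x: "x \<in> torus L - K" and m: "m \<le> card (nbrs L x \<inter> K)" and P': "P + 4 - 2 * real m \<le> P'"
    and Gamma: "2 * P' - 2 * h * (real (card K) + 1) \<le> Gamma_PCA h"
  shows "droplet L h s b\<^sub>0 P' (insert x K)"
proof -
  let ?R = "low_edges L h (droplet_energy L h s {} + Gamma_PCA h)"
  have fin: "finite K" using K finite_subset[OF _ finite_torus] by (auto simp: droplet_def)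
  have "droplet_energy L h s (insert x K) = droplet_energy L h s K - 2 * h
    + 2 * (real (card (nbrs L x)) - 2 * real (card (nbrs L x \<inter> K)))"
    by (rule droplet_energy_insert[OF L x])
  moreover have "real (card (nbrs L x)) \<le> 4" using card_nbrs_le[of L x] L x by simp
  moreover have "droplet_energy L h s K \<le> droplet_energy L h s {} + 2 * P - 2 * h * card K"
    using K by (simp add: droplet_def)
  moreover have "real m \<le> real (card (nbrs L x \<inter> K))" using m by simp
  ultimately have "droplet_energy L h s (insert x K) \<le> droplet_energy L h s {} + 2 * P - 2 * h * card K
      - 2 * h + 2 * (4 - 2 * real m)"
    by (simp add: algebra_simps)
  also have "\<dots> \<le> droplet_energy L h s {} + 2 * P' - 2 * h * card (insert x K)"
    using P' x fin by (simp add: algebra_simps)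
  finally have E: "droplet_energy L h s (insert x K) \<le> \<dots>" .
  have E': "droplet_energy L h s (insert x K) \<le> droplet_energy L h s {} + Gamma_PCA h"
    using E Gamma x fin by (simp add: algebra_simps)
  define b where "b = even (fst x + snd x)"
  have "half_config L s (\<not> b) (insert x K) = half_config L s (\<not> b) K"
    by (rule half_config_insert) (simp add: b_def)
  then have 1: "(half_config L s b\<^sub>0 {}, half_config L s (\<not> b) (insert x K)) \<in> ?R\<^sup>*"
    using K by (simp add: droplet_def)
  have "(half_config L s (\<not> b) (insert x K), half_config L s b (insert x K)) \<in> ?R"
    using E' pair_energy_half_config[of L h s "\<not> b" "insert x K"] half_config_in_configs[OF s]
    by (simp add: low_edges_def)
  with 1 have 2: "(half_config L s b\<^sub>0 {}, half_config L s b (insert x K)) \<in> ?R\<^sup>*"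
    by (rule rtrancl_into_rtrancl)
  have "(half_config L s b\<^sub>0 {}, half_config L s c (insert x K)) \<in> ?R\<^sup>*" for c
    using 1 2 by (cases "c = b") auto
  then show ?thesis using E K x by (simp add: droplet_def)
qed

lemma droplet_empty:
  assumes h: "0 < h" "h < 1" and s: "s = -1 \<or> s = 1"
  shows "droplet L h s b\<^sub>0 0 {}"
proof -
  let ?R = "low_edges L h (droplet_energy L h s {} + Gamma_PCA h)"
  \<comment> \<open>A droplet of one site already shows that the critical height is
    positive.\<close>
  have "0 \<le> Gamma_PCA h" using Gamma_PCA_ge[of h 1] h by simp
  then have "(half_config L s b\<^sub>0 {}, half_config L s (\<not> b\<^sub>0) {}) \<in> ?R"
    using pair_energy_half_config[of L h s b\<^sub>0 "{}"] half_config_in_configs[OF s]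
    by (simp add: low_edges_def)
  then have "(half_config L s b\<^sub>0 {}, half_config L s b {}) \<in> ?R\<^sup>*" for b
    by (cases "b = b\<^sub>0") auto
  then show ?thesis by (simp add: droplet_def)
qed

text \<open>A column and then a row are added to the square. For positive \<open>l\<close> the first
  site of each has one known neighbour and raises the perimeter bound by 2; each later site has two
  and keeps it. Contacts across the periodic boundary only help, as the bounds are
  one-sided.\<close>

lemma droplet_square:
  assumes L: "even L" "2 \<le> L" and h: "0 < h" "h < 1" and s: "s = -1 \<or> s = 1"
    and "l \<le> L"
  shows "droplet L h s b\<^sub>0 (4 * real l) ({..<l} \<times> {..<l})"
  using \<open>l \<le> L\<close>
proof (induction l)
  case 0
  then show ?case using droplet_empty[OF h s] by simp
next
  case (Suc l)
  then have l: "l < L" by simp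
  from Suc have square: "droplet L h s b\<^sub>0 (4 * real l) ({..<l} \<times> {..<l})" by simp
  note ins = droplet_insert[OF L s]
  let ?Q = "{..<l} \<times> {..<l}" and ?R = "{..<Suc l} \<times> {..<l}"
  \<comment> \<open>The mean of the bounds at \<open>l\<close> and \<open>Suc l\<close>.
    \<open>Gamma1\<close> and \<open>Gamma2\<close> cover the first site of the column and of the
    row; later sites only lower the energy.\<close>
  have Gamma1: "2 * (4 * real l + 2) - 2 * h * ((real l)\<^sup>2 + 1) \<le> Gamma_PCA h"
    using Gamma_PCA_ge[OF h(1), of l] Gamma_PCA_ge[OF h(1), of "Suc l"]
    by (simp add: power2_eq_square algebra_simps)
  have Gamma2: "2 * (4 * real l + 4) - 2 * h * ((real l)\<^sup>2 + real l + 1) \<le> Gamma_PCA h"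
    using Gamma_PCA_ge[OF h(1), of "Suc l"] by (simp add: power2_eq_square algebra_simps)
  have column: "droplet L h s b\<^sub>0 (4 * real l + 2) (?Q \<union> {l} \<times> {..<m})" if "m \<le> l" "0 < m" for m
    using that
  proof (induction m)
    case (Suc m)
    have x: "(l, m) \<in> torus L - (?Q \<union> {l} \<times> {..<m})" using l Suc.prems by (auto simp: torus_def)
    have eq: "?Q \<union> {l} \<times> {..<Suc m} = insert (l, m) (?Q \<union> {l} \<times> {..<m})" by auto
    have "card (?Q \<union> {l} \<times> {..<m}) = l * l + m"
      by (subst card_Un_disjoint) auto
    then have G: "2 * (4 * real l + 2) - 2 * h * (real (card (?Q \<union> {l} \<times> {..<m})) + 1) \<le> Gamma_PCA h"
      using Gamma1 h by (simp add: power2_eq_square algebra_simps) (smt (verit) mult_nonneg_nonneg of_nat_0_le_iff)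
    obtain l' where l': "l = Suc l'" using Suc.prems by (cases l) auto
    have left: "(l', m) \<in> nbrs L (l, m) \<inter> (?Q \<union> {l} \<times> {..<m})"
      using nbrs_left[of l' m L] x l' Suc.prems by auto
    show ?case
    proof (cases m)
      case 0
      have "card {(l', m)} \<le> card (nbrs L (l, m) \<inter> (?Q \<union> {l} \<times> {..<m}))"
        using left by (intro card_mono) auto
      moreover have "droplet L h s b\<^sub>0 (4 * real l) (?Q \<union> {l} \<times> {..<m})"
        using square 0 by simp
      ultimately show ?thesis unfolding eq using x G by (intro ins[where m = 1]) auto
    next
      case (Suc m')
      have "(l, m') \<in> nbrs L (l, m) \<inter> (?Q \<union> {l} \<times> {..<m})"
        using nbrs_below[of l m' L] x Suc by auto
      then have "card {(l', m), (l, m')} \<le> card (nbrs L (l, m) \<inter> (?Q \<union> {l} \<times> {..<m}))"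
        using left by (intro card_mono) auto
      then have "2 \<le> card (nbrs L (l, m) \<inter> (?Q \<union> {l} \<times> {..<m}))" using l' by simp
      moreover have "droplet L h s b\<^sub>0 (4 * real l + 2) (?Q \<union> {l} \<times> {..<m})"
        using Suc.IH Suc.prems Suc by auto
      ultimately show ?thesis unfolding eq using x G by (intro ins[where m = 2]) auto
    qed
  qed simp
  have R: "?R = ?Q \<union> {l} \<times> {..<l}" by auto
  \<comment> \<open>For \<open>l = 0\<close> the column is empty and the bound stays 0; the first
    site of the row then has no known neighbour and raises it by 4.\<close>
  have start: "droplet L h s b\<^sub>0 (4 * real l + (if l = 0 then 0 else 2)) ?R"
    using column[of l] droplet_empty[OF h s, of L b\<^sub>0] unfolding R by auto
  have row: "droplet L h s b\<^sub>0 (4 * real l + 4) (?R \<union> {..<m} \<times> {l})" if "m \<le> Suc l" "0 < m" for m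
    using that
  proof (induction m)
    case (Suc m)
    have x: "(m, l) \<in> torus L - (?R \<union> {..<m} \<times> {l})" using l Suc.prems by (auto simp: torus_def)
    have eq: "?R \<union> {..<Suc m} \<times> {l} = insert (m, l) (?R \<union> {..<m} \<times> {l})" by auto
    have "card (?R \<union> {..<m} \<times> {l}) = Suc l * l + m"
      by (subst card_Un_disjoint) auto
    then have G: "2 * (4 * real l + 4) - 2 * h * (real (card (?R \<union> {..<m} \<times> {l})) + 1) \<le> Gamma_PCA h"
      using Gamma2 h by (simp add: power2_eq_square algebra_simps) (smt (verit) mult_nonneg_nonneg of_nat_0_le_iff)
    show ?case
    proof (cases m)
      case 0
      show ?thesis
      proof (cases l)
        case l0: 0
        have "droplet L h s b\<^sub>0 0 (?R \<union> {..<m} \<times> {l})" using start l0 0 by simp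
        then show ?thesis unfolding eq using x G l0 by (intro ins[where m = 0]) auto
      next
        case (Suc l')
        have "(m, l') \<in> nbrs L (m, l) \<inter> (?R \<union> {..<m} \<times> {l})"
          using nbrs_below[of m l' L] x Suc \<open>m = 0\<close> by auto
        then have "card {(m, l')} \<le> card (nbrs L (m, l) \<inter> (?R \<union> {..<m} \<times> {l}))"
          by (intro card_mono) auto
        moreover have "droplet L h s b\<^sub>0 (4 * real l + 2) (?R \<union> {..<m} \<times> {l})"
          using start Suc 0 by simp
        ultimately show ?thesis unfolding eq using x G by (intro ins[where m = 1]) auto
      qed
    next
      case (Suc m')
      then obtain l' where l': "l = Suc l'" using Suc.prems by (cases l) auto
      have "(m, l') \<in> nbrs L (m, l) \<inter> (?R \<union> {..<m} \<times> {l})"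
        using nbrs_below[of m l' L] x l' Suc.prems by auto
      moreover have "(m', l) \<in> nbrs L (m, l) \<inter> (?R \<union> {..<m} \<times> {l})"
        using nbrs_left[of m' l L] x Suc by auto
      ultimately have "card {(m, l'), (m', l)} \<le> card (nbrs L (m, l) \<inter> (?R \<union> {..<m} \<times> {l}))"
        by (intro card_mono) auto
      then have "2 \<le> card (nbrs L (m, l) \<inter> (?R \<union> {..<m} \<times> {l}))" using Suc by simp
      moreover have "droplet L h s b\<^sub>0 (4 * real l + 4) (?R \<union> {..<m} \<times> {l})"
        using Suc.IH Suc.prems Suc by auto
      ultimately show ?thesis unfolding eq using x G by (intro ins[where m = 2]) auto
    qed
  qed simp
  have "?R \<union> {..<Suc l} \<times> {l} = {..<Suc l} \<times> {..<Suc l}" by auto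
  with row[of "Suc l"] show ?case by (simp add: algebra_simps)
qed

text \<open>The square of side \<open>L\<close> is the whole torus, lower than the start by at least
  \<open>2 * h\<close> per site. The droplet energy of \<open>{}\<close> is the virtual energy of
  the start, so the height is measured from there.\<close>

lemma descends_half_config:
  assumes L: "even L" "2 \<le> L" and h: "0 < h" "h < 1" and s: "s = -1 \<or> s = 1"
  shows "descends L h (Gamma_PCA h) (half_config L s b {})"
proof -
  have torus: "torus L = {..<L} \<times> {..<L}" by (auto simp: torus_def)
  have "card (torus L) > 0" using L by (simp add: torus)
  have "virtual_energy L h (half_config L s b (torus L)) \<le> droplet_energy L h s (torus L)"
    unfolding pair_energy_half_config[symmetric, where b = b]
    by (intro virtual_energy_le_pair_energy half_config_in_configs[OF s])
  also have "\<dots> < virtual_energy L h (half_config L s b {})"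
    unfolding virtual_energy_half_config_empty[OF L h s] droplet_energy_torus[OF L]
    using h \<open>card (torus L) > 0\<close> by simp
  finally show ?thesis
    using droplet_square[OF L h s order.refl, of b] half_config_in_configs[OF s]
    unfolding descends_def virtual_energy_half_config_empty[OF L h s] droplet_def torus by blast
qed

section \<open>The special configurations and the conclusion\<close>

lemma minus_config_eq: "minus_config L = half_config L (-1) True {}"
  and chess_even_eq: "chess_even L = half_config L 1 False {}"
  and chess_odd_eq: "chess_odd L = half_config L 1 True {}"
  by (auto simp: minus_config_def chess_even_def chess_odd_def half_config_def restrict_def fun_eq_iff
      minus_one_power_iff)

text \<open>A configuration to which the hypothesis on \<open>Vstar\<close> applies; through
  \<open>descends_nonneg\<close> it gives the sign conditions of
  \<open>SES_hitting_gt\<close>.\<close>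

lemma exists_unstable_config:
  assumes "2 \<le> L"
  shows "\<exists>\<sigma>. \<sigma> \<in> configs L - {minus_config L, chess_even L, chess_odd L, plus_config L}"
proof -
  define \<sigma> where "\<sigma> = (minus_config L)((0, 0) := 1)"
  have "(0, 0) \<in> torus L" "(0, 1) \<in> torus L" "(1, 1) \<in> torus L" using assms by (auto simp: torus_def)
  then have "\<sigma> \<in> configs L"
    and "\<sigma> (0, 0) \<noteq> minus_config L (0, 0)" "\<sigma> (0, 1) \<noteq> plus_config L (0, 1)"
      "\<sigma> (1, 1) \<noteq> chess_even L (1, 1)" "\<sigma> (0, 0) \<noteq> chess_odd L (0, 0)"
    by (auto simp: \<sigma>_def configs_def minus_config_def plus_config_def chess_even_def chess_odd_def PiE_def extensional_def)
  then show ?thesis by (metis Diff_iff empty_iff insert_iff)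
qed

theorem theorem3p3:
  fixes L :: nat and h Vstar \<epsilon> :: real
  assumes "even L" and "L > 0"
    and "0 < h" and "h < 1"
    and "\<And>\<eta>. \<eta> \<in> configs L - {minus_config L, chess_even L, chess_odd L, plus_config L} \<Longrightarrow>
           stability_level L h \<eta> \<le> ereal Vstar"
    and "Vstar < Gamma_PCA h"
    and "\<epsilon> > 0"
  shows "SES (\<lambda>\<beta>. SUP \<eta>\<in>configs L.
           prob_hitting_gt L h \<beta> \<eta> {plus_config L, chess_even L, chess_odd L, minus_config L}
             (exp (\<beta> * (Vstar + \<epsilon>)))) \<and>
         SES (\<lambda>\<beta>. SUP \<eta>\<in>configs L.
           prob_hitting_gt L h \<beta> \<eta> {plus_config L} (exp (\<beta> * (Gamma_PCA h + \<epsilon>))))"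
proof
  have L: "2 \<le> L" using \<open>even L\<close> \<open>L > 0\<close> by (auto elim: evenE)
  let ?S = "{plus_config L, chess_even L, chess_odd L, minus_config L}"
  have desc: "descends L h V \<sigma>" if "\<sigma> \<in> configs L - ?S" "Vstar < V" for \<sigma> V
    using that assms(5)[of \<sigma>] by (intro stability_level_imp_descends) auto
  obtain \<zeta> where \<zeta>: "\<zeta> \<in> configs L - ?S" using exists_unstable_config[OF L] by blast
  \<comment> \<open>One half of \<epsilon> buys the strict gap needed to extract a path, the other
    is the slack of \<open>SES_hitting_gt\<close>.\<close>
  have "0 \<le> Vstar + \<epsilon> / 2"
    using desc[OF \<zeta>, of "Vstar + \<epsilon> / 2"] \<open>\<epsilon> > 0\<close> by (intro descends_nonneg) auto
  then have "SES (\<lambda>\<beta>. SUP \<eta>\<in>configs L. prob_hitting_gt L h \<beta> \<eta> ?S (exp (\<beta> * (Vstar + \<epsilon> / 2 + \<epsilon> / 2))))"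
    using desc \<open>\<epsilon> > 0\<close> by (intro SES_hitting_gt) auto
  then show "SES (\<lambda>\<beta>. SUP \<eta>\<in>configs L. prob_hitting_gt L h \<beta> \<eta> ?S (exp (\<beta> * (Vstar + \<epsilon>))))"
    by (simp add: add.assoc)
  \<comment> \<open>Droplet growth serves the three metastable configurations, the hypothesis on
    \<open>Vstar\<close> all those outside \<open>?S\<close>.\<close>
  have desc': "descends L h (Gamma_PCA h) \<sigma>" if "\<sigma> \<in> configs L - {plus_config L}" for \<sigma>
  proof (cases "\<sigma> \<in> ?S")
    case True
    then show ?thesis
      using that descends_half_config[OF \<open>even L\<close> L \<open>0 < h\<close> \<open>h < 1\<close>]
      by (auto simp: minus_config_eq chess_even_eq chess_odd_eq)
  qed (use that desc \<open>Vstar < Gamma_PCA h\<close> in auto)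
  have "0 \<le> Gamma_PCA h"
    using desc'[of \<zeta>] \<zeta> by (intro descends_nonneg) auto
  then show "SES (\<lambda>\<beta>. SUP \<eta>\<in>configs L. prob_hitting_gt L h \<beta> \<eta> {plus_config L} (exp (\<beta> * (Gamma_PCA h + \<epsilon>))))"
    using desc' \<open>\<epsilon> > 0\<close> by (intro SES_hitting_gt) auto
qed

end
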